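(* Assume that the objective function $F$ satisfies Assumption (F-basic) and that the diffusion coefficient $\sigma$ satisfies Assumption ($\sigma$-basic), as spelled out in the context. There exist positive real numbers $H\in(0,h_{\max})$ and $C\in(0,\infty)$ such that, for any initial value $x_0\in\mathbb{R}^d$, all $N\in\mathbb{N}^\star$ and all $h\in(0,H)$, the iterates $X_n$ of the stochastic gradient scheme with step size $h$ and $X_0=x_0$ satisfy: (1) (weak error) for any mapping $\varphi:\mathbb{R}^d\to\mathbb{R}$ of class $\mathcal{C}^2$ with bounded second order derivative, \[ \big|\mathbb{E}[\varphi(X_N)]-\varphi(x^\star)\big|\le C_1(\varphi,x_0)\bigl(e^{-\mu Nh}+h\bigr),\qquad C_1(\varphi,x_0)=C\bigl(\|\nabla\varphi(x^\star)\|+|||\varphi|||_2\bigr)\bigl(1+\|x_0-x^\star\|^3\bigr); \] (2) (expected residual) \[ \mathbb{E}[F(X_N)]-F(x^\star)\le C\bigl(1+\|x_0-x^\star\|^3\bigr)\bigl(e^{-2\mu Nh}+h\bigr); \] (3) (strong error) \[ \mathbb{E}[\|X_N-x^\star\|]\le \bigl(\mathbb{E}[\|X_N-x^\star\|^2]\bigr)^{\frac12}\le C\bigl(1+\|x_0-x^\star\|^{\frac32}\bigr)\bigl(e^{-\mu Nh}+h^{\frac12}\bigr). \]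
   Context: Notation: $\mathbb{N}=\{0,1,\dots\}$, $\mathbb{N}^\star=\{1,2,\dots\}$, $d\in\mathbb{N}^\star$; $\|\cdot\|$ is the Euclidean norm on $\mathbb{R}^d$ and the Frobenius norm on the space $\mathcal{M}_d(\mathbb{R})$ of real $d\times d$ matrices. For $\varphi:\mathbb{R}^d\to\mathbb{R}$ of class $\mathcal{C}^m$, $|||\varphi|||_m=\sup_{x\in\mathbb{R}^d}\sup_{k_1,\dots,k_m\neq0}\frac{|D^m\varphi(x).(k_1,\dots,k_m)|}{\|k_1\|\cdots\|k_m\|}$. A positive real number $h_{\max}$ is fixed; step sizes satisfy $h\in(0,h_{\max})$, and $t_n=nh$. Scheme: for deterministic $x_0\in\mathbb{R}^d$ and $h\in(0,h_{\max})$, $X_0=x_0$ and $X_{n+1}=X_n-h\nabla F(X_n)+h\sigma(t_n,X_n)\gamma_{n+1}$ for $n\in\mathbb{N}$, where $(\gamma_n)_{n\ge1}$ are independent standard centered Gaussian random variables in $\mathbb{R}^d$. Assumption (F-basic): $F:\mathbb{R}^d\to\mathbb{R}$ is of class $\mathcal{C}^3$; there is $L_F\in(0,\infty)$ with $\|\nabla F(x_2)-\nabla F(x_1)\|\le L_F\|x_2-x_1\|$ for all $x_1,x_2$; there is $\mu\in(0,\infty)$ with $\langle\nabla F(x_2)-\nabla F(x_1),x_2-x_1\rangle\ge\mu\|x_2-x_1\|^2$ for all $x_1,x_2$; the third order derivative of $F$ is bounded. Under this assumption $F$ has a unique minimizer, denoted $x^\star$. The $\mu$ in the claim is this constant. Assumption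 ($\sigma$-basic): $\sigma:[0,\infty)\times\mathbb{R}^d\to\mathcal{M}_d(\mathbb{R})$ is continuous, and there is a bounded mapping $\varsigma:[0,\infty)\to[0,\infty)$ such that for all $t\ge0$: $\|\sigma(t,x_2)-\sigma(t,x_1)\|\le\varsigma(t)\|x_2-x_1\|$ for all $x_1,x_2\in\mathbb{R}^d$, and $\sup_{x\in\mathbb{R}^d}\frac{\|\sigma(t,x)\|}{1+\|x-x^\star\|}\le\varsigma(t)$. *)

theory Defs
  imports "HOL-Probability.Probability"
begin

section \<open>Differential calculus\<close>

definition grad :: "('a::real_inner \<Rightarrow> real) \<Rightarrow> 'a \<Rightarrow> 'a" where
  "grad f x = (THE g. GDERIV f x :> g)"

text \<open>On a finite-dimensional space, \<open>f\<close> is of class \<open>C\<^sup>m\<^sup>+\<^sup>1\<close> iff it is Frechet differentiable and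
  all its directional derivatives are of class \<open>C\<^sup>m\<close>.\<close>

primrec C_class :: "nat \<Rightarrow> ('a::euclidean_space \<Rightarrow> real) \<Rightarrow> bool" where
  "C_class 0 f \<longleftrightarrow> continuous_on UNIV f"
| "C_class (Suc m) f \<longleftrightarrow>
     (\<forall>x. f differentiable (at x)) \<and> (\<forall>v. C_class m (\<lambda>x. frechet_derivative f (at x) v))"

text \<open>\<open>Dm f [k\<^sub>1, \<dots>, k\<^sub>m] x\<close> is \<open>D\<^sup>mf(x).(k\<^sub>1, \<dots>, k\<^sub>m)\<close>.\<close>

primrec Dm :: "('a::euclidean_space \<Rightarrow> real) \<Rightarrow> 'a list \<Rightarrow> 'a \<Rightarrow> real" where
  "Dm f [] x = f x"
| "Dm f (k # ks) x = frechet_derivative (Dm f ks) (at x) k"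

definition Dm_quotients :: "nat \<Rightarrow> ('a::euclidean_space \<Rightarrow> real) \<Rightarrow> real set" where
  "Dm_quotients m f =
     {\<bar>Dm f ks x\<bar> / prod_list (map norm ks) | x ks. length ks = m \<and> 0 \<notin> set ks}"

definition bounded_Dm :: "nat \<Rightarrow> ('a::euclidean_space \<Rightarrow> real) \<Rightarrow> bool" where
  "bounded_Dm m f \<longleftrightarrow> bdd_above (Dm_quotients m f)"

text \<open>The seminorm \<open>|||f|||\<^sub>m\<close>; a real supremum, hence meaningful only under \<open>bounded_Dm m f\<close>.\<close>

definition Dm_norm :: "nat \<Rightarrow> ('a::euclidean_space \<Rightarrow> real) \<Rightarrow> real" where
  "Dm_norm m f = Sup (Dm_quotients m f)"


section \<open>Assumptions on the objective function and on the diffusion coefficient\<close>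

definition F_basic :: "(real^'n \<Rightarrow> real) \<Rightarrow> real \<Rightarrow> bool" where
  "F_basic F \<mu> \<longleftrightarrow>
     C_class 3 F \<and>
     (\<exists>L>0. \<forall>x1 x2. norm (grad F x2 - grad F x1) \<le> L * norm (x2 - x1)) \<and>
     \<mu> > 0 \<and>
     (\<forall>x1 x2. (grad F x2 - grad F x1) \<bullet> (x2 - x1) \<ge> \<mu> * (norm (x2 - x1))\<^sup>2) \<and>
     bounded_Dm 3 F"

text \<open>Under \<open>F_basic F \<mu>\<close> the function \<open>F\<close> has exactly one minimizer, so the choice made by
  \<^const>\<open>arg_min\<close> is the only possible one.\<close>

definition minimizer :: "(real^'n \<Rightarrow> real) \<Rightarrow> real^'n" where
  "minimizer F = (ARG_MIN F x. True)"

text \<open>The norm of \<open>real^'n^'n\<close> is the Frobenius norm.\<close>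

lemma norm_matrix_Frobenius:
  fixes A :: "real^'n^'n"
  shows "norm A = sqrt (\<Sum>i\<in>UNIV. \<Sum>j\<in>UNIV. (A $ i $ j)\<^sup>2)"
  by (simp add: norm_vec_def L2_set_def real_sqrt_pow2 sum_nonneg)

definition sigma_basic :: "(real \<Rightarrow> real^'n \<Rightarrow> real^'n^'n) \<Rightarrow> real^'n \<Rightarrow> bool" where
  "sigma_basic \<sigma> xstar \<longleftrightarrow>
     continuous_on ({0..} \<times> UNIV) (\<lambda>(t, x). \<sigma> t x) \<and>
     (\<exists>\<zeta> :: real \<Rightarrow> real.
        bounded (\<zeta> ` {0..}) \<and>
        (\<forall>t\<ge>0. \<zeta> t \<ge> 0 \<and>
          (\<forall>x1 x2. norm (\<sigma> t x2 - \<sigma> t x1) \<le> \<zeta> t * norm (x2 - x1)) \<and>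
          (\<forall>x. norm (\<sigma> t x) / (1 + norm (x - xstar)) \<le> \<zeta> t)))"


section \<open>The stochastic gradient scheme\<close>

definition std_gaussian :: "'w measure \<Rightarrow> ('w \<Rightarrow> real^'n) \<Rightarrow> bool" where
  "std_gaussian M Y \<longleftrightarrow>
     distributed M lborel Y (\<lambda>y. ennreal (\<Prod>i\<in>UNIV. std_normal_density (y $ i)))"

text \<open>Only \<open>\<gamma> 1, \<gamma> 2, \<dots>\<close> are used; \<open>\<gamma> 0\<close> is irrelevant.\<close>

primrec sg_scheme ::
  "(real^'n \<Rightarrow> real) \<Rightarrow> (real \<Rightarrow> real^'n \<Rightarrow> real^'n^'n) \<Rightarrow> (nat \<Rightarrow> 'w \<Rightarrow> real^'n)
    \<Rightarrow> real^'n \<Rightarrow> real \<Rightarrow> nat \<Rightarrow> 'w \<Rightarrow> real^'n" where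
  "sg_scheme F \<sigma> \<gamma> x0 h 0 \<omega> = x0"
| "sg_scheme F \<sigma> \<gamma> x0 h (Suc n) \<omega> =
     sg_scheme F \<sigma> \<gamma> x0 h n \<omega>
     - h *\<^sub>R grad F (sg_scheme F \<sigma> \<gamma> x0 h n \<omega>)
     + h *\<^sub>R (\<sigma> (real n * h) (sg_scheme F \<sigma> \<gamma> x0 h n \<omega>) *v \<gamma> (Suc n) \<omega>)"

end

(* The proof is discrete and avoids the limiting equation. Write Y_n = X_n - xstar and
   m_n = E|Y_n|^2. Since the noise is centered with identity covariance and independent of X_n,
   strong monotonicity and the Lipschitz bound give
   m_(n+1) <= (1 - 2 mu h + O(h^2)) m_n + O(h^2).
   The factor 1 - rho h + O(h^2) costs exp(O(N h^2)), which is harmless if N h^2 <= 1 and is absorbed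
   into the additive error O(h) otherwise; hence m_N = O(exp(- 2 mu N h) + h) with the exact rate.
   For the weak error, linearize the gradient at xstar with A the Hessian there:
   E Y_(n+1) = (I - h A) E Y_n + h O(m_n), and |I - h A| <= 1 - mu h + O(h^2), whose powers dominate
   those of the factor in m_n, so E Y_N = O(exp(- mu N h) + h). A second order Taylor expansion of the
   test function at xstar then only involves E Y_N and m_N. *)

theory Submission
  imports Defs
begin

text \<open>Cauchy-Schwarz applied to the second moment would bound the bias E Y_N only by a square
  root, hence with an error of order sqrt(h). Order h for the weak error therefore needs a recursion
  of its own for E Y_n. The obstacle there is that expectation and gradient do not commute; the
  bounded third derivative makes the remainder of the linearization quadratic, so that the second
  moment, already estimated, controls it. This forcing decays at almost twice the rate of the bias.
  Equal rates would produce an extra factor N h; for small h the two one-step factors differ by at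
  least \<open>\<mu> * h / 2\<close>, which compensates the factor h in front of the forcing. The
  residual inherits the rate of the second moment because F grows at most quadratically around its
  minimizer. All estimates depend at most quadratically on the initial distance; the exponents 3 and
  3/2 of the claim enter only at the end, through elementary inequalities.\<close>

section \<open>Perturbed linear recursions and powers\<close>

text \<open>If \<open>N h\<^sup>2 > 1\<close>, the left-hand side is at most \<open>exp (- \<rho> / (2 h)) \<le> 2 h / \<rho>\<close>: this is the
  origin of the additive term.\<close>

lemma perturbed_power_bound:
  fixes \<rho> A h :: real
  assumes "0 < \<rho>" "0 \<le> A" "0 < h" "A * h \<le> \<rho> / 2" "\<rho> * h \<le> 1"
  shows "(1 - \<rho> * h + A * h\<^sup>2) ^ N \<le> exp A * exp (- \<rho> * real N * h) + 2 / \<rho> * h"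
proof -
  have "(1 - \<rho> * h + A * h\<^sup>2) ^ N \<le> exp (- \<rho> * h + A * h\<^sup>2) ^ N"
  proof (rule power_mono)
    show "1 - \<rho> * h + A * h\<^sup>2 \<le> exp (- \<rho> * h + A * h\<^sup>2)"
      using exp_ge_add_one_self[of "- \<rho> * h + A * h\<^sup>2"] by linarith
    have "0 \<le> A * h\<^sup>2" using assms by simp
    then show "0 \<le> 1 - \<rho> * h + A * h\<^sup>2" using assms by linarith
  qed
  also have "\<dots> = exp (- \<rho> * real N * h + A * (real N * h\<^sup>2))"
    by (simp add: exp_of_nat_mult[symmetric] algebra_simps)
  also have "\<dots> \<le> exp A * exp (- \<rho> * real N * h) + 2 / \<rho> * h"
  proof (cases "real N * h\<^sup>2 \<le> 1")
    case True
    then have "A * (real N * h\<^sup>2) \<le> A" using assms(2) by (simp add: mult_left_le)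
    then have "exp (- \<rho> * real N * h + A * (real N * h\<^sup>2)) \<le> exp (A + - \<rho> * real N * h)"
      by simp
    also have "\<dots> = exp A * exp (- \<rho> * real N * h)" by (rule exp_add)
    finally show ?thesis using assms by (smt (verit) divide_nonneg_nonneg mult_nonneg_nonneg)
  next
    case False
    have h: "1 / h \<le> real N * h" using False assms(3) by (simp add: field_simps power2_eq_square)
    have "A * h * (real N * h) \<le> \<rho> / 2 * (real N * h)"
      using assms by (intro mult_right_mono) auto
    then have "- \<rho> * real N * h + A * (real N * h\<^sup>2) \<le> - (\<rho> / 2 * (real N * h))"
      by (simp add: power2_eq_square algebra_simps)
    also have "\<dots> \<le> - (\<rho> / 2 * (1 / h))"
      using h assms(1) by (simp only: neg_le_iff_le) (intro mult_left_mono, auto)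
    finally have "exp (- \<rho> * real N * h + A * (real N * h\<^sup>2)) \<le> exp (- (\<rho> / 2 * (1 / h)))" by simp
    also have "\<dots> = 1 / exp (\<rho> / 2 * (1 / h))" by (simp add: exp_minus field_simps)
    also have "\<dots> \<le> 1 / (\<rho> / 2 * (1 / h))"
    proof (rule divide_left_mono)
      show "\<rho> / 2 * (1 / h) \<le> exp (\<rho> / 2 * (1 / h))"
        using exp_ge_add_one_self[of "\<rho> / 2 * (1 / h)"] by linarith
    qed (use assms in auto)
    also have "\<dots> = 2 / \<rho> * h" by simp
    finally show ?thesis by (smt (verit) exp_gt_zero mult_pos_pos)
  qed
  finally show ?thesis .
qed

text \<open>The level \<open>B / \<mu> * h\<close> is the fixed point of the recursion in which
  \<open>p\<close> is replaced by its upper bound \<open>1 - \<mu> * h\<close>. The initial value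
  keeps the factor \<open>p ^ n\<close> itself, since that bound would halve the rate when
  \<open>p\<close> is close to \<open>1 - 2 * \<mu> * h\<close>.\<close>

lemma affine_recursion_bound:
  fixes m :: "nat \<Rightarrow> real"
  assumes rec: "\<And>n. m (Suc n) \<le> p * m n + B * h\<^sup>2"
    and "0 \<le> p" "p \<le> 1 - \<mu> * h" "0 < \<mu>" "0 < h" "0 \<le> B"
  shows "m n \<le> p ^ n * m 0 + B / \<mu> * h"
proof (induction n)
  case 0
  then show ?case using assms by simp
next
  case (Suc n)
  have "m (Suc n) \<le> p * (p ^ n * m 0 + B / \<mu> * h) + B * h\<^sup>2"
    using rec[of n] mult_left_mono[OF Suc assms(2)] by linarith
  also have "\<dots> = p ^ Suc n * m 0 + (p * (B / \<mu> * h) + B * h\<^sup>2)" by (simp add: algebra_simps)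
  also have "p * (B / \<mu> * h) \<le> (1 - \<mu> * h) * (B / \<mu> * h)"
    using assms by (intro mult_right_mono) auto
  also have "(1 - \<mu> * h) * (B / \<mu> * h) + B * h\<^sup>2 = B / \<mu> * h"
    using assms(4) by (simp add: field_simps power2_eq_square)
  finally show ?case by simp
qed

text \<open>The forcing \<open>p ^ n\<close> decays faster than \<open>q ^ n\<close>, so it is compensated by carrying the negative
  term \<open>- \<delta> p ^ n\<close> through the induction.\<close>

lemma forced_recursion_bound:
  fixes b :: "nat \<Rightarrow> real"
  assumes rec: "\<And>n. b (Suc n) \<le> q * b n + h * \<kappa> * (p ^ n * s + D * h)"
    and "0 \<le> p" "0 \<le> q" "\<mu> * h / 2 \<le> q - p" "\<mu> * h / 2 \<le> 1 - q"
    and "0 < \<mu>" "0 < h" "0 \<le> \<kappa>" "0 \<le> s" "0 \<le> D"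
  shows "b n \<le> q ^ n * (b 0 + 2 * \<kappa> * s / \<mu>) + 2 * \<kappa> * D / \<mu> * h"
proof -
  \<comment> \<open>Both constants balance a forcing term against a gap:
    \<open>\<mu> * h / 2 * \<delta> = h * \<kappa> * s\<close> is paid by \<open>q - p\<close>, and
    \<open>\<mu> * h / 2 * \<epsilon> = h * \<kappa> * D\<close> by \<open>1 - q\<close>.\<close>
  define \<delta> where "\<delta> = 2 * \<kappa> * s / \<mu>"
  define \<epsilon> where "\<epsilon> = 2 * \<kappa> * D / \<mu>"
  have \<delta>: "0 \<le> \<delta>" and \<epsilon>: "0 \<le> \<epsilon>" using assms by (auto simp: \<delta>_def \<epsilon>_def)
  have "b n \<le> q ^ n * (b 0 + \<delta>) - p ^ n * \<delta> + \<epsilon> * h"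
  proof (induction n)
    case 0
    then show ?case using \<epsilon> assms by simp
  next
    case (Suc n)
    have "h * \<kappa> * (p ^ n * s) = \<mu> * h / 2 * (\<delta> * p ^ n)"
      using assms(6) by (simp add: \<delta>_def)
    also have "\<dots> \<le> (q - p) * (\<delta> * p ^ n)"
      using assms \<delta> by (intro mult_right_mono) auto
    finally have 1: "h * \<kappa> * (p ^ n * s) \<le> (q - p) * (\<delta> * p ^ n)" .
    have "h * \<kappa> * (D * h) = \<mu> * h / 2 * (\<epsilon> * h)"
      using assms(6) by (simp add: \<epsilon>_def)
    also have "\<dots> \<le> (1 - q) * (\<epsilon> * h)"
      using assms \<epsilon> by (intro mult_right_mono) auto
    finally have 2: "h * \<kappa> * (D * h) \<le> (1 - q) * (\<epsilon> * h)" .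
    have "b (Suc n) \<le> q * (q ^ n * (b 0 + \<delta>) - p ^ n * \<delta> + \<epsilon> * h) + (h * \<kappa> * (p ^ n * s) + h * \<kappa> * (D * h))"
      using rec[of n] mult_left_mono[OF Suc assms(3)] by (simp only: distrib_left)
    also have "\<dots> \<le> q * (q ^ n * (b 0 + \<delta>) - p ^ n * \<delta> + \<epsilon> * h)
        + ((q - p) * (\<delta> * p ^ n) + (1 - q) * (\<epsilon> * h))"
      using 1 2 by simp
    finally show ?case by (simp add: algebra_simps)
  qed
  moreover have "0 \<le> p ^ n * \<delta>" using \<delta> assms by simp
  ultimately show ?thesis unfolding \<delta>_def \<epsilon>_def by linarith
qed

text \<open>The recursions yield polynomials of degree two in the initial distance; these
  inequalities trade them for the cubic weight of the claim. The next lemma does the same for the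
  exponent 3/2.\<close>

lemma sq_le_one_plus_cube:
  fixes a :: real
  assumes "0 \<le> a"
  shows "a \<le> 1 + a ^ 3" "a\<^sup>2 \<le> 1 + a ^ 3"
proof -
  show "a\<^sup>2 \<le> 1 + a ^ 3" using assms power_increasing[of 2 3 a] power_le_one[of a 2]
    by (cases "a \<le> 1") (auto simp: add_increasing add_increasing2)
  show "a \<le> 1 + a ^ 3" using assms power_increasing[of 1 3 a]
    by (cases "a \<le> 1") (auto simp: add_increasing add_increasing2)
qed

lemma le_one_plus_powr:
  fixes a :: real
  assumes "0 \<le> a" "1 \<le> r"
  shows "a \<le> 1 + a powr r"
proof (cases "a \<le> 1")
  case False
  then have "a powr 1 \<le> a powr r" using assms by (intro powr_mono) auto
  then show ?thesis using False by simp
qed (simp add: add_increasing2)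

section \<open>Gradients and Taylor bounds\<close>

lemma GDERIV_unique:
  assumes "GDERIV f x :> g" "GDERIV f x :> g'"
  shows "g = g'"
proof -
  have "(\<lambda>h. h \<bullet> g) = (\<lambda>h. h \<bullet> g')"
    using assms unfolding gderiv_def by (rule has_derivative_unique)
  then have "\<And>h. h \<bullet> g = h \<bullet> g'" by (rule fun_cong)
  then show ?thesis using vector_eq_ldot[of g g'] by auto
qed

text \<open>As \<open>grad\<close> is a definite description, nothing is known about it before a
  gradient is exhibited. The witness is the Riesz representative of the derivative, assembled from
  its values on the basis.\<close>

lemma frechet_derivative_grad:
  fixes f :: "'a::euclidean_space \<Rightarrow> real"
  assumes "f differentiable (at x)"
  shows "frechet_derivative f (at x) v = grad f x \<bullet> v"
proof -
  define f' where "f' = frechet_derivative f (at x)"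
  define g where "g = (\<Sum>b\<in>Basis. f' b *\<^sub>R b)"
  have D: "(f has_derivative f') (at x)"
    using assms unfolding f'_def by (simp add: frechet_derivative_works)
  then interpret bounded_linear f' by (rule has_derivative_bounded_linear)
  have f': "f' v = v \<bullet> g" for v
  proof -
    have "f' v = f' (\<Sum>b\<in>Basis. (v \<bullet> b) *\<^sub>R b)" by (simp add: euclidean_representation)
    also have "\<dots> = v \<bullet> g" by (simp add: sum scaleR g_def inner_sum_right mult.commute)
    finally show ?thesis .
  qed
  have "GDERIV f x :> g"
    using D ext[of f' "\<lambda>h. h \<bullet> g", OF f'] unfolding gderiv_def by simp
  then have "grad f x = g"
    unfolding grad_def using GDERIV_unique by (intro the_equality) auto
  then show ?thesis using f' unfolding f'_def by (simp add: inner_commute)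
qed

section \<open>Second order Taylor estimates by restriction to lines\<close>

lemma DERIV_along_line:
  fixes f :: "'a::euclidean_space \<Rightarrow> real"
  assumes "\<And>z. f differentiable (at z)"
  shows "((\<lambda>s. f (x + s *\<^sub>R y)) has_real_derivative frechet_derivative f (at (x + s *\<^sub>R y)) y) (at s)"
proof -
  have D: "(f has_derivative frechet_derivative f (at (x + s *\<^sub>R y))) (at (x + s *\<^sub>R y))"
    using assms by (simp add: frechet_derivative_works[symmetric])
  then interpret bounded_linear "frechet_derivative f (at (x + s *\<^sub>R y))"
    by (rule has_derivative_bounded_linear)
  have "((\<lambda>s. f (x + s *\<^sub>R y)) has_derivative (\<lambda>t. frechet_derivative f (at (x + s *\<^sub>R y)) (t *\<^sub>R y))) (at s)"
    by (rule has_derivative_compose[where f = "\<lambda>s. x + s *\<^sub>R y" and g = f, OF _ D])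
      (auto intro!: derivative_eq_intros)
  then show ?thesis
    by (simp add: has_field_derivative_def scaleR mult_commute_abs)
qed

lemma Dm_Nil_fun: "Dm f [] = f"
  by (rule ext) simp

lemma Dm_Cons_fun: "Dm f (k # ks) = (\<lambda>x. frechet_derivative (Dm f ks) (at x) k)"
  by (rule ext) simp

text \<open>Maclaurin's formula with Lagrange remainder for \<open>f (x + s y)\<close> as a function
  of s in [0,1]. Only a bound in the single direction \<open>y\<close> is assumed, so that the lemma
  serves both for test functions and for the partial derivatives of the objective function.\<close>

lemma Taylor2_bound:
  fixes f :: "'a::euclidean_space \<Rightarrow> real"
  assumes f: "C_class 2 f" and B: "\<And>z. \<bar>Dm f [y, y] z\<bar> \<le> B"
  shows "\<bar>f (x + y) - f x - Dm f [y] x\<bar> \<le> B / 2"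
proof -
  define diff where "diff m s = Dm f (replicate m y) (x + s *\<^sub>R y)" for m s
  have D: "DERIV (diff m) t :> diff (Suc m) t" if "m < 2" for m t
  proof -
    have "Dm f (replicate m y) differentiable (at z)" for z
      using f that by (cases m) (auto simp: numeral_2_eq_2 Dm_Nil_fun Dm_Cons_fun)
    then have "((\<lambda>s. Dm f (replicate m y) (x + s *\<^sub>R y)) has_real_derivative
        frechet_derivative (Dm f (replicate m y)) (at (x + t *\<^sub>R y)) y) (at t)"
      by (rule DERIV_along_line)
    then show ?thesis by (simp add: diff_def[abs_def])
  qed
  obtain t where "diff 0 1 = (\<Sum>m<2. diff m 0 / fact m * 1 ^ m) + diff 2 t / fact 2 * 1 ^ 2"
    using Maclaurin2[of 1 diff "diff 0" 2] D by auto
  then have "f (x + y) - f x - Dm f [y] x = Dm f [y, y] (x + t *\<^sub>R y) / 2"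
    by (simp add: diff_def numeral_2_eq_2)
  then show ?thesis using B[of "x + t *\<^sub>R y"] by linarith
qed

lemma Dm_le_Dm_norm:
  assumes "bounded_Dm m f" "length ks = m" "0 \<notin> set ks"
  shows "\<bar>Dm f ks x\<bar> \<le> Dm_norm m f * prod_list (map norm ks)"
proof -
  have "\<bar>Dm f ks x\<bar> / prod_list (map norm ks) \<le> Dm_norm m f"
    unfolding Dm_norm_def using assms
    by (intro cSup_upper) (auto simp: bounded_Dm_def Dm_quotients_def)
  moreover have "0 < prod_list (map norm ks)"
    using assms(3) by (induction ks) auto
  ultimately show ?thesis by (simp add: field_simps)
qed

text \<open>A supremum of nonnegative quotients needs one member to be seen nonnegative: all
  directions are taken equal to one unit basis vector.\<close>

lemma Dm_norm_nonneg:
  fixes f :: "'a::euclidean_space \<Rightarrow> real"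
  assumes "bounded_Dm m f"
  shows "0 \<le> Dm_norm m f"
proof -
  obtain b :: 'a where b: "b \<in> Basis" using nonempty_Basis by blast
  have "\<bar>Dm f (replicate m b) 0\<bar> \<le> Dm_norm m f * prod_list (map norm (replicate m b))"
    using assms b nonzero_Basis by (intro Dm_le_Dm_norm) auto
  moreover have "prod_list (map norm (replicate m b)) = 1" using b by (induction m) auto
  ultimately show ?thesis by simp
qed

lemma Taylor2_Dm_norm:
  fixes f :: "'a::euclidean_space \<Rightarrow> real"
  assumes f: "C_class 2 f" and B: "bounded_Dm 2 f"
  shows "\<bar>f (x + y) - f x - grad f x \<bullet> y\<bar> \<le> Dm_norm 2 f / 2 * (norm y)\<^sup>2"
\<comment> \<open>The quotients behind \<open>Dm_norm\<close> exclude zero directions, so the bound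
  by the seminorm is available only for nonzero \<open>y\<close>.\<close>
proof (cases "y = 0")
  case False
  have "f differentiable (at z)" for z using f by (simp add: numeral_2_eq_2)
  then have "Dm f [y] x = grad f x \<bullet> y"
    by (simp add: frechet_derivative_grad Dm_Nil_fun)
  moreover have "\<bar>Dm f [y, y] z\<bar> \<le> Dm_norm 2 f * (norm y)\<^sup>2" for z
    using Dm_le_Dm_norm[OF B, of "[y, y]" z] False by (simp add: power2_eq_square del: Dm.simps)
  ultimately show ?thesis
    using Taylor2_bound[OF f, of y "Dm_norm 2 f * (norm y)\<^sup>2" x] by (simp del: Dm.simps)
qed simp

text \<open>The minimizer is an arbitrary choice until a minimizer is known to exist. Integrating
  strong monotonicity along rays from 0 gives quadratic growth, which confines the search to a
  compact ball.\<close>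

lemma strongly_monotone_grad_minimizer:
  fixes F :: "real^'n \<Rightarrow> real"
  assumes diff: "\<And>x. F differentiable (at x)" and \<mu>: "0 < \<mu>"
    and mono: "\<And>x1 x2. (grad F x2 - grad F x1) \<bullet> (x2 - x1) \<ge> \<mu> * (norm (x2 - x1))\<^sup>2"
  shows "grad F (minimizer F) = 0" "F (minimizer F) \<le> F x"
proof -
  have line: "((\<lambda>s. F (x + s *\<^sub>R y)) has_real_derivative grad F (x + s *\<^sub>R y) \<bullet> y) (at s)" for x y s
    using DERIV_along_line[of F, OF diff] diff by (simp add: frechet_derivative_grad)
  have growth: "F 0 + grad F 0 \<bullet> y + \<mu> / 2 * (norm y)\<^sup>2 \<le> F y" for y
  proof -
    \<comment> \<open>\<open>g\<close> is F along the ray minus the linear and quadratic terms of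
      the claimed lower bound; the claim is exactly \<open>g 0 \<le> g 1\<close>.\<close>
    define g where "g s = F (0 + s *\<^sub>R y) - s * (grad F 0 \<bullet> y) - \<mu> / 2 * s\<^sup>2 * (norm y)\<^sup>2" for s
    have "((\<lambda>s. s * (grad F 0 \<bullet> y)) has_real_derivative grad F 0 \<bullet> y) (at s)" for s
      by (auto intro!: derivative_eq_intros)
    moreover have "((\<lambda>s. \<mu> / 2 * s\<^sup>2 * (norm y)\<^sup>2) has_real_derivative \<mu> * s * (norm y)\<^sup>2) (at s)" for s
      by (auto intro!: derivative_eq_intros)
    moreover have "((\<lambda>s. F (0 + s *\<^sub>R y)) has_real_derivative grad F (s *\<^sub>R y) \<bullet> y) (at s)" for s
      using line[of 0 y s] by simp
    ultimately have D: "(g has_real_derivative grad F (s *\<^sub>R y) \<bullet> y - grad F 0 \<bullet> y - \<mu> * s * (norm y)\<^sup>2) (at s)" for s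
      unfolding g_def[abs_def] by (intro DERIV_diff) auto
    have D0: "0 \<le> grad F (s *\<^sub>R y) \<bullet> y - grad F 0 \<bullet> y - \<mu> * s * (norm y)\<^sup>2" if "0 \<le> s" for s
    proof (cases "s = 0")
      case False
      \<comment> \<open>Monotonicity between 0 and the point at parameter \<open>s\<close> yields
        the wanted inequality multiplied by \<open>s\<close>, hence the separate case
        \<open>s = 0\<close>.\<close>
      have "s * (\<mu> * s * (norm y)\<^sup>2) \<le> s * (grad F (s *\<^sub>R y) \<bullet> y - grad F 0 \<bullet> y)"
        using mono[where ?x2.0 = "s *\<^sub>R y" and ?x1.0 = 0]
        by (simp add: inner_diff_left power2_eq_square algebra_simps)
      then show ?thesis using False that by simp
    qed simp
    have "g 0 \<le> g 1"
    proof (rule DERIV_nonneg_imp_nondecreasing[of 0 1 g])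
      show "\<exists>z. (g has_real_derivative z) (at s) \<and> 0 \<le> z" if "0 \<le> s" "s \<le> 1" for s
        by (intro exI conjI) (rule D, rule D0, rule that(1))
    qed simp
    then show ?thesis by (simp add: g_def)
  qed
  have cont: "continuous_on S F" for S
    using diff by (intro continuous_at_imp_continuous_on ballI differentiable_imp_continuous_within)
  \<comment> \<open>Outside the ball of this radius the quadratic term of the growth bound outweighs
    the linear one, so F is at least \<open>F 0\<close> there.\<close>
  define R where "R = 2 * norm (grad F 0) / \<mu>"
  have R: "0 \<le> R" using \<mu> by (simp add: R_def)
  obtain z where z: "z \<in> cball 0 R" "\<forall>y\<in>cball 0 R. F z \<le> F y"
    using continuous_attains_inf[of "cball 0 R" F] cont R by auto
  have "F z \<le> F y" for y
  proof (cases "norm y \<le> R")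
    case False
    have "- (norm (grad F 0) * norm y) \<le> grad F 0 \<bullet> y"
      using Cauchy_Schwarz_ineq2[of "grad F 0" y] by linarith
    moreover have "norm (grad F 0) * norm y \<le> \<mu> / 2 * (norm y)\<^sup>2"
    proof -
      have "norm (grad F 0) \<le> \<mu> / 2 * norm y" using False \<mu> by (simp add: R_def field_simps)
      from mult_right_mono[OF this norm_ge_zero[of y]] show ?thesis
        by (simp add: power2_eq_square mult.assoc)
    qed
    moreover have "F z \<le> F 0" using z R by simp
    ultimately show ?thesis using growth[of y] by linarith
  qed (use z in auto)
  then have "is_arg_min F (\<lambda>_. True) z" by (simp add: is_arg_min_linorder)
  then have min: "is_arg_min F (\<lambda>_. True) (minimizer F)"
    unfolding minimizer_def arg_min_def by (rule someI)
  then show "F (minimizer F) \<le> F x" by (simp add: is_arg_min_linorder)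
  \<comment> \<open>Moving in the direction of the gradient itself makes the derivative at the
    minimum equal to the squared norm of the gradient.\<close>
  define g where "g = grad F (minimizer F)"
  have "g \<bullet> g = 0"
  proof (rule DERIV_local_min)
    show "((\<lambda>s. F (minimizer F + s *\<^sub>R g)) has_real_derivative g \<bullet> g) (at 0)"
      using line[of "minimizer F" g 0] by (simp add: g_def)
    show "\<forall>s. \<bar>0 - s\<bar> < 1 \<longrightarrow> F (minimizer F + 0 *\<^sub>R g) \<le> F (minimizer F + s *\<^sub>R g)"
      using min by (simp add: is_arg_min_linorder)
  qed simp
  then show "grad F (minimizer F) = 0" by (simp add: g_def)
qed

text \<open>\<open>A\<close> is the Hessian at \<open>x\<close>, written through second directional
  derivatives. Each component of the gradient is a function \<open>Dm F [b]\<close> to which the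
  second order Taylor bound applies; summing the components, with the norm below the l1 norm, puts
  the dimension into \<open>K\<close>.\<close>

lemma grad_linearization:
  fixes F :: "'a::euclidean_space \<Rightarrow> real"
  assumes F: "C_class 3 F" "bounded_Dm 3 F"
  obtains A K where "bounded_linear A" "0 \<le> K"
    "\<And>y. norm (grad F (x + y) - grad F x - A y) \<le> K * (norm y)\<^sup>2"
proof
  define A where "A y = (\<Sum>b\<in>Basis. Dm F [y, b] x *\<^sub>R b)" for y
  define K where "K = real DIM('a) * (Dm_norm 3 F / 2)"
  have dF: "F differentiable (at z)" for z using F by (simp add: numeral_3_eq_3)
  have C2: "C_class 2 (Dm F [b])" for b
    using F(1) by (simp add: numeral_3_eq_3 numeral_2_eq_2 Dm_Nil_fun Dm_Cons_fun)
  then have "Dm F [b] differentiable (at x)" for b by (simp add: numeral_2_eq_2)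
  then have "bounded_linear (frechet_derivative (Dm F [b]) (at x))" for b
    by (meson frechet_derivative_works has_derivative_bounded_linear)
  then have "bounded_linear (\<lambda>y. Dm F [y, b] x)" for b by simp
  then show "bounded_linear A"
    unfolding A_def[abs_def]
    by (intro bounded_linear_sum bounded_linear_compose[OF bounded_linear_scaleR_left])
  show "0 \<le> K" using Dm_norm_nonneg[OF F(2)] by (simp add: K_def)
  show "norm (grad F (x + y) - grad F x - A y) \<le> K * (norm y)\<^sup>2" for y
  proof (cases "y = 0")
    case True
    interpret bounded_linear A by fact
    show ?thesis using True by (simp add: zero)
  next
    case False
    have "\<bar>(grad F (x + y) - grad F x - A y) \<bullet> b\<bar> \<le> Dm_norm 3 F / 2 * (norm y)\<^sup>2" if b: "b \<in> Basis" for b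
    proof -
      have "\<bar>Dm F [y, y, b] z\<bar> \<le> Dm_norm 3 F * (norm y)\<^sup>2" for z
        using Dm_le_Dm_norm[OF F(2), of "[y, y, b]" z] b False
        by (simp add: power2_eq_square nonzero_Basis del: Dm.simps)
      \<comment> \<open>The last entry of a direction list is the innermost derivative, so the third
        derivative in \<open>[y, y, b]\<close> is a second derivative of
        \<open>Dm F [b]\<close>.\<close>
      then have 1: "\<bar>Dm (Dm F [b]) [y, y] z\<bar> \<le> Dm_norm 3 F * (norm y)\<^sup>2" for z
        by (simp only: Dm_Cons_fun Dm_Nil_fun)
      have "A y \<bullet> b = Dm F [y, b] x"
        using b by (simp add: A_def inner_sum_left inner_Basis if_distrib del: Dm.simps cong: if_cong)
      moreover have "Dm F [b] z = grad F z \<bullet> b" for z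
        using dF by (simp add: frechet_derivative_grad Dm_Nil_fun)
      ultimately show ?thesis
        using Taylor2_bound[OF C2, of b y, OF 1, of x]
        by (simp only: inner_diff_left Dm_Cons_fun Dm_Nil_fun times_divide_eq_left)
    qed
    then have "(\<Sum>b\<in>Basis. \<bar>(grad F (x + y) - grad F x - A y) \<bullet> b\<bar>)
        \<le> (\<Sum>b\<in>(Basis::'a set). Dm_norm 3 F / 2 * (norm y)\<^sup>2)"
      by (intro sum_mono)
    then show ?thesis
      using norm_le_l1[of "grad F (x + y) - grad F x - A y"] by (simp add: K_def)
  qed
qed

text \<open>The inequality for \<open>A\<close> is the limit \<open>t \<rightarrow> 0\<close> of the one for \<open>G (t y) / t\<close>.\<close>

lemma linearization_coercive:
  fixes A :: "'a::real_inner \<Rightarrow> 'a"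
  assumes "linear A" "\<And>y. norm (G y - A y) \<le> K * (norm y)\<^sup>2" "\<And>y. \<mu> * (norm y)\<^sup>2 \<le> G y \<bullet> y"
  shows "\<mu> * (norm y)\<^sup>2 \<le> A y \<bullet> y"
proof -
  interpret linear A by fact
  have "\<mu> * (norm y)\<^sup>2 - t * (K * (norm y) ^ 3) \<le> A y \<bullet> y" if t: "0 < t" for t
  proof -
    have "\<mu> * (norm (t *\<^sub>R y))\<^sup>2 \<le> A (t *\<^sub>R y) \<bullet> (t *\<^sub>R y) + (G (t *\<^sub>R y) - A (t *\<^sub>R y)) \<bullet> (t *\<^sub>R y)"
      using assms(3)[of "t *\<^sub>R y"] by (simp only: inner_add_left[symmetric]) simp
    also have "(G (t *\<^sub>R y) - A (t *\<^sub>R y)) \<bullet> (t *\<^sub>R y)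
        \<le> norm (G (t *\<^sub>R y) - A (t *\<^sub>R y)) * norm (t *\<^sub>R y)"
      by (rule norm_cauchy_schwarz)
    also have "\<dots> \<le> K * (norm (t *\<^sub>R y))\<^sup>2 * norm (t *\<^sub>R y)"
      by (intro mult_right_mono assms(2)) auto
    finally have "t\<^sup>2 * (\<mu> * (norm y)\<^sup>2) \<le> t\<^sup>2 * (A y \<bullet> y + t * (K * (norm y) ^ 3))"
      using t by (simp add: scale power_mult_distrib power2_eq_square power3_eq_cube algebra_simps)
    then show ?thesis using t by (simp add: mult_le_cancel_left)
  qed
  moreover have "((\<lambda>t. \<mu> * (norm y)\<^sup>2 - t * (K * (norm y) ^ 3)) \<longlongrightarrow>
      \<mu> * (norm y)\<^sup>2 - 0 * (K * (norm y) ^ 3)) (at_right 0)"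
    by (intro tendsto_intros)
  ultimately show ?thesis
    by (intro tendsto_upperbound[of "\<lambda>t. \<mu> * (norm y)\<^sup>2 - t * (K * (norm y) ^ 3)" _ "at_right 0"])
      (auto simp: eventually_at_right_less eventually_at_filter)
qed

text \<open>Mean value theorem on the segment from \<open>xs\<close> to \<open>x\<close>.
  Integration would gain a factor 1/2, which only affects the final constant.\<close>

lemma gap_le_of_grad_growth:
  fixes F :: "real^'n \<Rightarrow> real"
  assumes diff: "\<And>x. F differentiable (at x)" and g: "\<And>x. norm (grad F x) \<le> L * norm (x - xs)" and "0 \<le> L"
  shows "F x - F xs \<le> L * (norm (x - xs))\<^sup>2"
proof -
  define y where "y = x - xs"
  have "\<And>s. ((\<lambda>s. F (xs + s *\<^sub>R y)) has_real_derivative grad F (xs + s *\<^sub>R y) \<bullet> y) (at s)"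
    using DERIV_along_line[of F, OF diff] diff by (simp add: frechet_derivative_grad)
  then obtain s where s: "0 < s" "s < 1" "F x - F xs = grad F (xs + s *\<^sub>R y) \<bullet> y"
    using MVT2[of 0 1 "\<lambda>s. F (xs + s *\<^sub>R y)" "\<lambda>s. grad F (xs + s *\<^sub>R y) \<bullet> y"] by (auto simp: y_def)
  note s(3)
  also have "grad F (xs + s *\<^sub>R y) \<bullet> y \<le> norm (grad F (xs + s *\<^sub>R y)) * norm y"
    by (rule norm_cauchy_schwarz)
  also have "\<dots> \<le> (L * norm y) * norm y"
  proof (rule mult_right_mono)
    have "norm (grad F (xs + s *\<^sub>R y)) \<le> L * (s * norm y)" using g[of "xs + s *\<^sub>R y"] s by simp
    also have "\<dots> \<le> L * norm y" using s assms(3) by (intro mult_left_mono) (auto simp: mult_left_le_one_le)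
    finally show "norm (grad F (xs + s *\<^sub>R y)) \<le> L * norm y" .
  qed simp
  finally show ?thesis by (simp add: y_def power2_eq_square mult.assoc)
qed

section \<open>Adding an independent Gaussian increment\<close>

lemma vec_axis_nth: "axis i x $ j = (if j = i then x else 0)"
  by (simp add: axis_def)

text \<open>Fubini for product functions. \<open>lborel\<close> is the image of a product measure
  indexed by basis vectors, whereas the factors here are indexed by coordinates; the work is the
  translation between the two index sets.\<close>

lemma integrable_lborel_vec_prod:
  fixes f :: "'n::finite \<Rightarrow> real \<Rightarrow> real"
  assumes f: "\<And>i. integrable lborel (f i)"
  shows "integrable lborel (\<lambda>y::real^'n. \<Prod>i\<in>UNIV. f i (y $ i))"
    and "(\<integral>y. (\<Prod>i\<in>UNIV. f i ((y :: real^'n) $ i)) \<partial>lborel) = (\<Prod>i\<in>UNIV. integral\<^sup>L lborel (f i))"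
proof -
  interpret product_sigma_finite "\<lambda>_. lborel :: real measure" ..
  \<comment> \<open>\<open>ix\<close> recovers the coordinate \<open>i\<close> from the basis vector
    \<open>axis i 1\<close>; its other values are irrelevant.\<close>
  define ix where "ix b = (THE i. b = axis i (1::real))" for b :: "real^'n"
  have ix: "ix (axis i 1) = i" for i :: 'n
    unfolding ix_def by (auto simp: axis_eq_axis)
  have Basis: "(Basis :: (real^'n) set) = (\<lambda>i. axis i 1) ` UNIV"
    by (auto simp: Basis_vec_def)
  have inj: "inj (\<lambda>i::'n. axis i (1::real))"
    by (auto simp: inj_on_def axis_eq_axis)
  have [measurable]: "f i \<in> borel_measurable borel" for i
    using borel_measurable_integrable[OF f[of i]] by simp
  have prod_eq: "(\<Prod>i\<in>UNIV. f i ((\<Sum>b\<in>Basis. g b *\<^sub>R b :: real^'n) $ i)) = (\<Prod>b\<in>Basis. f (ix b) (g b))" for g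
  proof -
    have "(\<Sum>b\<in>Basis. g b *\<^sub>R b :: real^'n) $ i = g (axis i 1)" for i
      by (simp add: Basis sum.reindex[OF inj] vec_axis_nth if_distrib cong: if_cong)
    then show ?thesis by (simp add: Basis prod.reindex[OF inj] ix)
  qed
  have "(\<lambda>g. \<Sum>b\<in>Basis. g b *\<^sub>R b :: real^'n) \<in> measurable (\<Pi>\<^sub>M b\<in>Basis. lborel) borel" by measurable
  then show "integrable lborel (\<lambda>y::real^'n. \<Prod>i\<in>UNIV. f i (y $ i))"
    "(\<integral>y. (\<Prod>i\<in>UNIV. f i ((y :: real^'n) $ i)) \<partial>lborel) = (\<Prod>i\<in>UNIV. integral\<^sup>L lborel (f i))"
    using product_integrable_prod[of "Basis :: (real^'n) set" "\<lambda>b. f (ix b)"]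
      product_integral_prod[of "Basis :: (real^'n) set" "\<lambda>b. f (ix b)"] f
    by (simp_all add: lborel_eq[where 'a="real^'n"] integrable_distr_eq integral_distr prod_eq
      del: sum_component)
      (simp add: Basis prod.reindex[OF inj] ix)
qed

text \<open>All moments are instances of one monomial formula: with exponents \<open>e i\<close> the
  expectation is the product of the one-dimensional moments of orders \<open>e i\<close>. An
  exponent 1 makes the product vanish.\<close>

lemma std_gaussian_moments:
  fixes Y :: "'w \<Rightarrow> real^'n"
  assumes G: "std_gaussian M Y"
  shows "integrable M (\<lambda>\<omega>. Y \<omega> $ j)" "(\<integral>\<omega>. Y \<omega> $ j \<partial>M) = 0"
    and "integrable M (\<lambda>\<omega>. Y \<omega> $ j * Y \<omega> $ k)"
    and "(\<integral>\<omega>. Y \<omega> $ j * Y \<omega> $ k \<partial>M) = of_bool (j = k)"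
proof -
  note D = G[unfolded std_gaussian_def]
  have nonneg: "0 \<le> (\<Prod>i\<in>UNIV. std_normal_density (y $ i))" for y :: "real^'n"
    by (intro prod_nonneg) auto
  let ?f = "\<lambda>j x. std_normal_density x * (x::real) ^ (j::nat)"
  have int: "integrable lborel (?f a)" for a by (rule integrable_std_normal_moment)
  have m: "integral\<^sup>L lborel (?f 0) = 1" "integral\<^sup>L lborel (?f 1) = 0" "integral\<^sup>L lborel (?f 2) = 1"
    using integral_std_normal_moment_even[of 0] integral_std_normal_moment_even[of 1]
      integral_std_normal_moment_odd[of 0] by (simp_all add: fact_numeral)
  have meas: "integrable M (\<lambda>\<omega>. \<Prod>i\<in>UNIV. Y \<omega> $ i ^ e i)"
    "(\<integral>\<omega>. (\<Prod>i\<in>UNIV. Y \<omega> $ i ^ e i) \<partial>M) = (\<Prod>i\<in>UNIV. integral\<^sup>L lborel (?f (e i)))"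
    for e :: "'n \<Rightarrow> nat"
  proof -
    note P = integrable_lborel_vec_prod[of "\<lambda>i. ?f (e i)", OF int]
    have [measurable]: "(\<lambda>y::real^'n. \<Prod>i\<in>UNIV. y $ i ^ e i) \<in> borel_measurable lborel" by measurable
    show "integrable M (\<lambda>\<omega>. \<Prod>i\<in>UNIV. Y \<omega> $ i ^ e i)"
      using P(1) distributed_integrable[OF D _ nonneg, of "\<lambda>y. \<Prod>i\<in>UNIV. y $ i ^ e i"]
      by (simp add: prod.distrib)
    show "(\<integral>\<omega>. (\<Prod>i\<in>UNIV. Y \<omega> $ i ^ e i) \<partial>M) = (\<Prod>i\<in>UNIV. integral\<^sup>L lborel (?f (e i)))"
      using P(2) distributed_integral[OF D _ nonneg, of "\<lambda>y. \<Prod>i\<in>UNIV. y $ i ^ e i"]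
      by (simp add: prod.distrib)
  qed
  have single: "(\<Prod>i\<in>UNIV. y $ i ^ (of_bool (i = j))) = y $ j" for y :: "real^'n"
    by (simp add: of_bool_def if_distrib prod.delta cong: if_cong)
  have single': "(\<Prod>i\<in>UNIV. y $ i ^ (of_bool (i = k))) = y $ k" for y :: "real^'n"
    by (simp add: of_bool_def if_distrib prod.delta cong: if_cong)
  show "integrable M (\<lambda>\<omega>. Y \<omega> $ j)"
    using meas(1)[of "\<lambda>i. of_bool (i = j)"] by (simp only: single)
  have "(\<Prod>i\<in>UNIV. integral\<^sup>L lborel (?f (of_bool (i = j)))) = 0"
    using m(2) by (intro prod_zero) (auto intro!: bexI[of _ j])
  then show "(\<integral>\<omega>. Y \<omega> $ j \<partial>M) = 0"
    using meas(2)[of "\<lambda>i. of_bool (i = j)"] by (simp only: single)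
  \<comment> \<open>The sum of two indicators covers both cases: exponent 2 at \<open>j\<close> if
    \<open>j = k\<close>, exponent 1 at each of two coordinates otherwise.\<close>
  let ?e = "\<lambda>i. of_bool (i = j) + of_bool (i = k) :: nat"
  have pair: "(\<Prod>i\<in>UNIV. y $ i ^ ?e i) = y $ j * y $ k" for y :: "real^'n"
    by (simp only: power_add prod.distrib single single')
  show "integrable M (\<lambda>\<omega>. Y \<omega> $ j * Y \<omega> $ k)"
    using meas(1)[of ?e] by (simp only: pair)
  have "(\<Prod>i\<in>UNIV. integral\<^sup>L lborel (?f (?e i))) = of_bool (j = k)"
  proof (cases "j = k")
    case True
    have "integral\<^sup>L lborel (?f (?e i)) = 1" for i using True m by (cases "i = k") (auto simp: numeral_2_eq_2)
    then show ?thesis using True by simp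
  next
    case False
    then have "(\<Prod>i\<in>UNIV. integral\<^sup>L lborel (?f (?e i))) = 0"
      using m(2) by (intro prod_zero) (auto intro!: bexI[of _ j])
    then show ?thesis using False by simp
  qed
  then show "(\<integral>\<omega>. Y \<omega> $ j * Y \<omega> $ k \<partial>M) = of_bool (j = k)"
    using meas(2)[of ?e] by (simp only: pair)
qed

lemma borel_measurable_matrix_vector_mult:
  fixes f :: "'a \<Rightarrow> real^'n^'m" and g :: "'a \<Rightarrow> real^'n"
  assumes "f \<in> borel_measurable M" "g \<in> borel_measurable M"
  shows "(\<lambda>x. f x *v g x) \<in> borel_measurable M"
  using assms
  by (rule borel_measurable_continuous_Pair)
    (auto simp: matrix_vector_mult_def intro!: continuous_intros)

lemma (in finite_measure) integrable_of_square_norm: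
  fixes f :: "'a \<Rightarrow> 'b::{banach, second_countable_topology}"
  assumes [measurable]: "f \<in> borel_measurable M" and f: "integrable M (\<lambda>x. (norm (f x))\<^sup>2)"
  shows "integrable M f"
proof (rule Bochner_Integration.integrable_bound)
  show "integrable M (\<lambda>x. 1 + (norm (f x))\<^sup>2)" using f by simp
  have "r \<le> 1 + r\<^sup>2" if "0 \<le> r" for r :: real
    using sum_power2_ge_zero[of "r - 1" 0] that by (simp add: power2_diff)
  then show "AE x in M. norm (f x) \<le> norm (1 + (norm (f x))\<^sup>2)" by (simp add: add_nonneg_nonneg)
qed simp

text \<open>Here \<open>Z\<close> carries the past and \<open>g\<close> is the new noise. The
  squared norm is expanded into scalar monomials so that independence factors every expectation:
  terms linear in the noise have mean zero, and the identity covariance leaves only the squared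
  entries of \<open>w\<close>, whose sum is the squared Frobenius norm.\<close>

lemma (in prob_space) indep_gaussian_step:
  fixes u :: "'z \<Rightarrow> real^'n" and w :: "'z \<Rightarrow> real^'n^'n" and Z Z' :: "'a \<Rightarrow> 'z"
  assumes ind: "indep_var N Z N' Z'"
      \<comment> \<open>\<open>indep_var\<close> forces \<open>Z\<close> and \<open>Z'\<close> to have the same type, hence the detour through \<open>r\<close>\<close>
    and r: "r \<in> borel_measurable N'" and g_eq: "\<And>\<omega>. g \<omega> = r (Z' \<omega>)"
    and g: "std_gaussian M g"
    and u[measurable]: "u \<in> borel_measurable N" and w[measurable]: "w \<in> borel_measurable N"
    and u2: "integrable M (\<lambda>\<omega>. (norm (u (Z \<omega>)))\<^sup>2)" and w2: "integrable M (\<lambda>\<omega>. (norm (w (Z \<omega>)))\<^sup>2)"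
  shows "integrable M (\<lambda>\<omega>. (norm (u (Z \<omega>) + w (Z \<omega>) *v g \<omega>))\<^sup>2)"
    and "expectation (\<lambda>\<omega>. (norm (u (Z \<omega>) + w (Z \<omega>) *v g \<omega>))\<^sup>2)
      = expectation (\<lambda>\<omega>. (norm (u (Z \<omega>)))\<^sup>2) + expectation (\<lambda>\<omega>. (norm (w (Z \<omega>)))\<^sup>2)"
    and "expectation (\<lambda>\<omega>. u (Z \<omega>) + w (Z \<omega>) *v g \<omega>) = expectation (\<lambda>\<omega>. u (Z \<omega>))"
proof -
  have Z[measurable]: "Z \<in> measurable M N" and gm[measurable]: "g \<in> borel_measurable M"
    using indep_var_rv1[OF ind] measurable_compose[OF indep_var_rv2[OF ind] r]
    by (auto simp: g_eq[abs_def])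
  note G = std_gaussian_moments[OF g]
  \<comment> \<open>Integrability and value are kept together, so that finite sums can be assembled
    term by term without separate integrability proofs.\<close>
  have split: "has_bochner_integral M (\<lambda>\<omega>. f (Z \<omega>) * p (g \<omega>))
      (expectation (\<lambda>\<omega>. f (Z \<omega>)) * expectation (\<lambda>\<omega>. p (g \<omega>)))"
    if "f \<in> borel_measurable N" "p \<in> borel_measurable borel"
      "integrable M (\<lambda>\<omega>. f (Z \<omega>))" "integrable M (\<lambda>\<omega>. p (g \<omega>))" for f :: "'z \<Rightarrow> real" and p :: "_ \<Rightarrow> real"
  proof -
    have "indep_var borel (\<lambda>\<omega>. f (Z \<omega>)) borel (\<lambda>\<omega>. p (g \<omega>))"
      using indep_var_compose[OF ind that(1) measurable_compose[OF r that(2)]] by (simp add: comp_def g_eq)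
    with that(3,4) show ?thesis
      by (simp add: has_bochner_integral_iff indep_var_integrable indep_var_lebesgue_integral)
  qed
  have w_le: "\<bar>w z $ i $ j\<bar> \<le> norm (w z)" for z i j
    using component_le_norm_cart[of "w z $ i" j] Finite_Cartesian_Product.norm_nth_le[of "w z" i] by (rule order_trans)
  have u_le: "\<bar>u z $ i\<bar> \<le> norm (u z)" for z i
    by (rule component_le_norm_cart)
  have m[measurable]: "(\<lambda>z. u z $ i) \<in> borel_measurable N" "(\<lambda>z. w z $ i $ j) \<in> borel_measurable N" for i j
    by (intro measurable_compose[OF u borel_measurable_continuous_onI]
        measurable_compose[OF w borel_measurable_continuous_onI] continuous_intros)+
  have iww: "integrable M (\<lambda>\<omega>. w (Z \<omega>) $ i $ j * w (Z \<omega>) $ i $ k)" for i j k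
    by (rule Bochner_Integration.integrable_bound[OF w2])
      (auto simp: power2_eq_square abs_mult intro!: mult_mono w_le)
  have iuu: "integrable M (\<lambda>\<omega>. (u (Z \<omega>) $ i)\<^sup>2)" for i
    by (rule Bochner_Integration.integrable_bound[OF u2])
      (use power_mono[OF u_le abs_ge_zero, of _ _ 2] in auto)
  have iuw: "integrable M (\<lambda>\<omega>. u (Z \<omega>) $ i * w (Z \<omega>) $ i $ j)" for i j
  proof (rule Bochner_Integration.integrable_bound[OF Bochner_Integration.integrable_add[OF u2 w2]])
    have "\<bar>u z $ i * w z $ i $ j\<bar> \<le> (norm (u z))\<^sup>2 + (norm (w z))\<^sup>2" for z
    proof -
      have "\<bar>u z $ i * w z $ i $ j\<bar> \<le> norm (u z) * norm (w z)"
        unfolding abs_mult by (intro mult_mono u_le w_le) auto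
      also have "\<dots> \<le> (norm (u z))\<^sup>2 + (norm (w z))\<^sup>2"
        using sum_squares_bound[of "norm (u z)" "norm (w z)"]
          mult_nonneg_nonneg[OF norm_ge_zero[of "u z"] norm_ge_zero[of "w z"]] by linarith
      finally show ?thesis .
    qed
    then show "AE \<omega> in M. norm (u (Z \<omega>) $ i * w (Z \<omega>) $ i $ j)
        \<le> norm ((norm (u (Z \<omega>)))\<^sup>2 + (norm (w (Z \<omega>)))\<^sup>2)" by simp
  qed simp
  have iw: "integrable M (\<lambda>\<omega>. w (Z \<omega>) $ i $ j)" for i j
    by (rule integrable_of_square_norm) (use iww[of i j j] in \<open>auto simp: power2_eq_square\<close>)
  have iu: "integrable M (\<lambda>\<omega>. u (Z \<omega>) $ i)" for i
    by (rule integrable_of_square_norm) (use iuu[of i] in auto)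
  have wg: "has_bochner_integral M (\<lambda>\<omega>. w (Z \<omega>) $ i $ j * g \<omega> $ j) 0" for i j
    using split[of "\<lambda>z. w z $ i $ j" "\<lambda>x. x $ j"] iw G by simp
  have uwg: "has_bochner_integral M (\<lambda>\<omega>. u (Z \<omega>) $ i * w (Z \<omega>) $ i $ j * g \<omega> $ j) 0" for i j
    using split[of "\<lambda>z. u z $ i * w z $ i $ j" "\<lambda>x. x $ j"] iuw G by simp
  have wwgg: "has_bochner_integral M (\<lambda>\<omega>. w (Z \<omega>) $ i $ j * w (Z \<omega>) $ i $ k * (g \<omega> $ j * g \<omega> $ k))
      (if j = k then expectation (\<lambda>\<omega>. (w (Z \<omega>) $ i $ j)\<^sup>2) else 0)" for i j k
    using split[of "\<lambda>z. w z $ i $ j * w z $ i $ k" "\<lambda>x. x $ j * x $ k"] iww G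
    by (cases "j = k") (simp_all add: power2_eq_square)
  define V where "V i \<omega> = u (Z \<omega>) $ i + (\<Sum>j\<in>UNIV. w (Z \<omega>) $ i $ j * g \<omega> $ j)" for i \<omega>
  have V: "(u (Z \<omega>) + w (Z \<omega>) *v g \<omega>) $ i = V i \<omega>" for \<omega> i
    by (simp add: V_def matrix_vector_mult_def)
  have V1: "has_bochner_integral M (V i) (expectation (\<lambda>\<omega>. u (Z \<omega>) $ i))" for i
    using has_bochner_integral_add[OF has_bochner_integral_integrable[OF iu[of i]]
        has_bochner_integral_sum[of UNIV, OF wg[of i]]]
    by (simp add: V_def[abs_def])
  have V2: "has_bochner_integral M (\<lambda>\<omega>. (V i \<omega>)\<^sup>2)
      (expectation (\<lambda>\<omega>. (u (Z \<omega>) $ i)\<^sup>2) + (\<Sum>j\<in>UNIV. expectation (\<lambda>\<omega>. (w (Z \<omega>) $ i $ j)\<^sup>2)))" for i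
  proof -
    have "(V i \<omega>)\<^sup>2 = (u (Z \<omega>) $ i)\<^sup>2
        + (2 * (\<Sum>j\<in>UNIV. u (Z \<omega>) $ i * w (Z \<omega>) $ i $ j * g \<omega> $ j)
        + (\<Sum>j\<in>UNIV. \<Sum>k\<in>UNIV. w (Z \<omega>) $ i $ j * w (Z \<omega>) $ i $ k * (g \<omega> $ j * g \<omega> $ k)))" for \<omega>
    proof -
      have 1: "(\<Sum>j\<in>UNIV. w (Z \<omega>) $ i $ j * g \<omega> $ j)\<^sup>2
          = (\<Sum>j\<in>UNIV. \<Sum>k\<in>UNIV. w (Z \<omega>) $ i $ j * w (Z \<omega>) $ i $ k * (g \<omega> $ j * g \<omega> $ k))"
        unfolding power2_eq_square sum_product by (simp only: mult_ac)
      have 2: "u (Z \<omega>) $ i * (\<Sum>j\<in>UNIV. w (Z \<omega>) $ i $ j * g \<omega> $ j)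
          = (\<Sum>j\<in>UNIV. u (Z \<omega>) $ i * w (Z \<omega>) $ i $ j * g \<omega> $ j)"
        unfolding sum_distrib_left by (simp only: mult_ac)
      show ?thesis unfolding V_def power2_sum 1 2[symmetric] by simp
    qed
    moreover have "has_bochner_integral M (\<lambda>\<omega>. (u (Z \<omega>) $ i)\<^sup>2
        + (2 * (\<Sum>j\<in>UNIV. u (Z \<omega>) $ i * w (Z \<omega>) $ i $ j * g \<omega> $ j)
        + (\<Sum>j\<in>UNIV. \<Sum>k\<in>UNIV. w (Z \<omega>) $ i $ j * w (Z \<omega>) $ i $ k * (g \<omega> $ j * g \<omega> $ k))))
        (expectation (\<lambda>\<omega>. (u (Z \<omega>) $ i)\<^sup>2) + (2 * (\<Sum>j\<in>(UNIV::'n set). 0)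
        + (\<Sum>j\<in>UNIV. \<Sum>k\<in>UNIV. if j = k then expectation (\<lambda>\<omega>. (w (Z \<omega>) $ i $ j)\<^sup>2) else 0)))"
      by (rule has_bochner_integral_add has_bochner_integral_sum has_bochner_integral_mult_right
          has_bochner_integral_integrable iuu uwg wwgg)+
    ultimately show ?thesis by simp
  qed
  have norm_V: "(norm (u (Z \<omega>) + w (Z \<omega>) *v g \<omega>))\<^sup>2 = (\<Sum>i\<in>UNIV. (V i \<omega>)\<^sup>2)" for \<omega>
    unfolding norm_vec_def L2_set_def by (simp only: V real_norm_def power2_abs) (simp add: sum_nonneg)
  have norm_u: "(norm (u z))\<^sup>2 = (\<Sum>i\<in>UNIV. (u z $ i)\<^sup>2)" for z
    by (simp add: norm_vec_def L2_set_def sum_nonneg)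
  have norm_w: "(norm (w z))\<^sup>2 = (\<Sum>i\<in>UNIV. \<Sum>j\<in>UNIV. (w z $ i $ j)\<^sup>2)" for z
    by (simp add: norm_matrix_Frobenius sum_nonneg)
  have "has_bochner_integral M (\<lambda>\<omega>. (norm (u (Z \<omega>) + w (Z \<omega>) *v g \<omega>))\<^sup>2)
      (\<Sum>i\<in>UNIV. expectation (\<lambda>\<omega>. (u (Z \<omega>) $ i)\<^sup>2) + (\<Sum>j\<in>UNIV. expectation (\<lambda>\<omega>. (w (Z \<omega>) $ i $ j)\<^sup>2)))"
    unfolding norm_V by (intro has_bochner_integral_sum V2)
  also have "(\<Sum>i\<in>UNIV. expectation (\<lambda>\<omega>. (u (Z \<omega>) $ i)\<^sup>2) + (\<Sum>j\<in>UNIV. expectation (\<lambda>\<omega>. (w (Z \<omega>) $ i $ j)\<^sup>2)))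
      = expectation (\<lambda>\<omega>. (norm (u (Z \<omega>)))\<^sup>2) + expectation (\<lambda>\<omega>. (norm (w (Z \<omega>)))\<^sup>2)"
    using iuu iww[of i j j for i j] unfolding norm_u norm_w power2_eq_square[symmetric] by (simp add: sum.distrib)
  finally show sq: "integrable M (\<lambda>\<omega>. (norm (u (Z \<omega>) + w (Z \<omega>) *v g \<omega>))\<^sup>2)"
    and "expectation (\<lambda>\<omega>. (norm (u (Z \<omega>) + w (Z \<omega>) *v g \<omega>))\<^sup>2)
      = expectation (\<lambda>\<omega>. (norm (u (Z \<omega>)))\<^sup>2) + expectation (\<lambda>\<omega>. (norm (w (Z \<omega>)))\<^sup>2)"
    by (auto simp: has_bochner_integral_iff)
  have [measurable]: "(\<lambda>\<omega>. w (Z \<omega>) *v g \<omega>) \<in> borel_measurable M"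
    by (rule borel_measurable_matrix_vector_mult) auto
  have iV: "integrable M (\<lambda>\<omega>. u (Z \<omega>) + w (Z \<omega>) *v g \<omega>)"
    by (rule integrable_of_square_norm) (use sq in auto)
  have iU: "integrable M (\<lambda>\<omega>. u (Z \<omega>))"
    by (rule integrable_of_square_norm) (use u2 in auto)
  show "expectation (\<lambda>\<omega>. u (Z \<omega>) + w (Z \<omega>) *v g \<omega>) = expectation (\<lambda>\<omega>. u (Z \<omega>))"
    using V1 integral_bounded_linear[OF bounded_linear_vec_nth iV] integral_bounded_linear[OF bounded_linear_vec_nth iU]
    by (simp add: vec_eq_iff V has_bochner_integral_iff del: vector_add_component)
qed

section \<open>The stochastic gradient iteration\<close>

text \<open>The iterate of index \<open>n\<close> depends only on the noises 1 to \<open>n\<close>.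
  It is thus a function of a finite family that is independent of the next noise.\<close>

lemma sg_scheme_cong:
  assumes "\<And>i. 1 \<le> i \<Longrightarrow> i \<le> n \<Longrightarrow> \<gamma> i \<omega> = \<gamma>' i \<omega>'"
  shows "sg_scheme F \<sigma> \<gamma> x0 h n \<omega> = sg_scheme F \<sigma> \<gamma>' x0 h n \<omega>'"
  using assms by (induction n) auto

text \<open>Only one-point estimates around \<open>xs\<close> are recorded; \<open>grad_le\<close>
  contains the fact that the gradient vanishes at \<open>xs\<close>. The gradient and its
  linearization \<open>A\<close> share the constants \<open>L\<close> and \<open>\<mu>\<close>, so
  one contraction argument covers both.\<close>

locale sg_iteration = prob_space M for M :: "'w measure" +
  fixes \<gamma> :: "nat \<Rightarrow> 'w \<Rightarrow> real^'n"
    and F :: "real^'n \<Rightarrow> real"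
    and \<sigma> :: "real \<Rightarrow> real^'n \<Rightarrow> real^'n^'n"
    and xs :: "real^'n" and A :: "real^'n \<Rightarrow> real^'n" and \<mu> L S K :: real
  assumes indep: "indep_vars (\<lambda>_. borel) \<gamma> {1..}"
    and gaussian: "\<And>n. n \<ge> 1 \<Longrightarrow> std_gaussian M (\<gamma> n)"
    and const: "0 < \<mu>" "0 \<le> L" "0 \<le> S" "0 \<le> K"
    and grad_cont: "continuous_on UNIV (grad F)"
    and grad_le: "\<And>x. norm (grad F x) \<le> L * norm (x - xs)"
    and grad_mono: "\<And>x. \<mu> * (norm (x - xs))\<^sup>2 \<le> grad F x \<bullet> (x - xs)"
    and \<sigma>_cont: "\<And>t. 0 \<le> t \<Longrightarrow> continuous_on UNIV (\<sigma> t)"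
    and \<sigma>_le: "\<And>t x. 0 \<le> t \<Longrightarrow> norm (\<sigma> t x) \<le> S * (1 + norm (x - xs))"
    and A: "bounded_linear A" "\<And>y. norm (A y) \<le> L * norm y" "\<And>y. \<mu> * (norm y)\<^sup>2 \<le> A y \<bullet> y"
    and grad_lin: "\<And>x. norm (grad F x - A (x - xs)) \<le> K * (norm (x - xs))\<^sup>2"
begin

text \<open>Noise and space are left free because two instances occur: the given noises on
  \<open>M\<close>, and the coordinate projections on a finite product space.\<close>

lemma sg_scheme_measurable:
  assumes "\<And>i. 1 \<le> i \<Longrightarrow> i \<le> n \<Longrightarrow> \<gamma>' i \<in> borel_measurable N" "0 \<le> h"
  shows "sg_scheme F \<sigma> \<gamma>' x0 h n \<in> borel_measurable N"
  using assms
proof (induction n)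
  case 0
  then show ?case by simp
next
  case (Suc n)
  then have X[measurable]: "sg_scheme F \<sigma> \<gamma>' x0 h n \<in> borel_measurable N" by simp
  have [measurable]: "grad F \<in> borel_measurable borel" "\<sigma> (real n * h) \<in> borel_measurable borel"
    using Suc by (auto intro!: borel_measurable_continuous_onI grad_cont \<sigma>_cont)
  have "(\<lambda>\<omega>. \<sigma> (real n * h) (sg_scheme F \<sigma> \<gamma>' x0 h n \<omega>) *v \<gamma>' (Suc n) \<omega>) \<in> borel_measurable N"
    using Suc by (intro borel_measurable_matrix_vector_mult) auto
  then show ?case by simp
qed

text \<open>Expanding the square, coercivity controls the cross term and the linear bound the last
  one. The vector \<open>c\<close> is generic: it becomes the gradient in the second moment and
  \<open>A y\<close> in the bias.\<close>

lemma step_norm: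
  assumes "c \<bullet> y \<ge> \<mu> * (norm y)\<^sup>2" "norm c \<le> L * norm y" "0 < h"
  shows "(norm (y - h *\<^sub>R c))\<^sup>2 \<le> (1 - 2 * \<mu> * h + L\<^sup>2 * h\<^sup>2) * (norm y)\<^sup>2"
proof -
  have "(norm (y - h *\<^sub>R c))\<^sup>2 = (norm y)\<^sup>2 - 2 * h * (c \<bullet> y) + h\<^sup>2 * (norm c)\<^sup>2"
    by (simp only: power2_norm_eq_inner)
      (simp add: inner_diff_left inner_diff_right inner_commute power2_eq_square algebra_simps)
  moreover have "h\<^sup>2 * (norm c)\<^sup>2 \<le> h\<^sup>2 * (L * norm y)\<^sup>2"
    using assms by (intro mult_left_mono power_mono) auto
  moreover have "2 * h * (\<mu> * (norm y)\<^sup>2) \<le> 2 * h * (c \<bullet> y)" using assms by (intro mult_left_mono) auto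
  ultimately show ?thesis by (simp add: power_mult_distrib algebra_simps)
qed

text \<open>The square root of the previous factor \<open>1 + 2 x\<close> is at most
  \<open>1 + x\<close>, as the square of the latter exceeds it by x squared. This turns the rate
  \<open>2 * \<mu>\<close> for squares into exactly \<open>\<mu>\<close> for norms.\<close>

lemma linear_step_norm:
  assumes "0 < h" "\<mu> * h \<le> 1"
  shows "norm (y - h *\<^sub>R A y) \<le> (1 - \<mu> * h + L\<^sup>2 / 2 * h\<^sup>2) * norm y"
proof (rule power2_le_imp_le)
  have "1 - 2 * \<mu> * h + L\<^sup>2 * h\<^sup>2 \<le> (1 - \<mu> * h + L\<^sup>2 / 2 * h\<^sup>2)\<^sup>2"
    using zero_le_power2[of "- \<mu> * h + L\<^sup>2 / 2 * h\<^sup>2"] by (simp add: power2_eq_square algebra_simps)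
  then show "(norm (y - h *\<^sub>R A y))\<^sup>2 \<le> ((1 - \<mu> * h + L\<^sup>2 / 2 * h\<^sup>2) * norm y)\<^sup>2"
    using step_norm[OF A(3) A(2) assms(1), of y] by (simp add: power_mult_distrib)
      (meson mult_right_mono order_trans zero_le_power2)
  have "0 \<le> L\<^sup>2 / 2 * h\<^sup>2" by simp
  then show "0 \<le> (1 - \<mu> * h + L\<^sup>2 / 2 * h\<^sup>2) * norm y"
    using assms(2) by (intro mult_nonneg_nonneg norm_ge_zero) linarith
qed

lemma moment_step:
  assumes h: "0 < h" "\<mu> * h \<le> 1"
    and X: "X = sg_scheme F \<sigma> \<gamma> x0 h"
    and int: "integrable M (\<lambda>\<omega>. (norm (X n \<omega> - xs))\<^sup>2)"
  shows "integrable M (\<lambda>\<omega>. (norm (X (Suc n) \<omega> - xs))\<^sup>2)"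
    and "expectation (\<lambda>\<omega>. (norm (X (Suc n) \<omega> - xs))\<^sup>2)
      \<le> (1 - 2 * \<mu> * h + (L\<^sup>2 + 2 * S\<^sup>2) * h\<^sup>2) * expectation (\<lambda>\<omega>. (norm (X n \<omega> - xs))\<^sup>2) + 2 * S\<^sup>2 * h\<^sup>2"
    and "norm (expectation (\<lambda>\<omega>. X (Suc n) \<omega> - xs))
      \<le> (1 - \<mu> * h + L\<^sup>2 / 2 * h\<^sup>2) * norm (expectation (\<lambda>\<omega>. X n \<omega> - xs))
        + h * K * expectation (\<lambda>\<omega>. (norm (X n \<omega> - xs))\<^sup>2)"
proof -
  \<comment> \<open>The iterate is factored as \<open>T (Z \<omega>)\<close>, with \<open>Z\<close>
    the noises 1 to \<open>n\<close> and \<open>T\<close> the scheme run on coordinate projections.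
    Since {1..n} and {Suc n} are disjoint, \<open>Z\<close> is independent of the next
    noise.\<close>
  define N where "N = PiM {1..n} (\<lambda>_. borel :: (real^'n) measure)"
  define Z where "Z \<omega> = restrict (\<lambda>i. \<gamma> i \<omega>) {1..n}" for \<omega>
  define T where "T = sg_scheme F \<sigma> (\<lambda>i f. f i) x0 h n"
  have XT: "X n \<omega> = T (Z \<omega>)" for \<omega>
    unfolding X T_def Z_def by (rule sg_scheme_cong) simp
  have T[measurable]: "T \<in> borel_measurable N"
    unfolding T_def N_def using h by (intro sg_scheme_measurable measurable_component_singleton) auto
  have [measurable]: "grad F \<in> borel_measurable borel" "\<sigma> (real n * h) \<in> borel_measurable borel"
    using h by (auto intro!: borel_measurable_continuous_onI grad_cont \<sigma>_cont)
  have ind: "indep_var N Z (PiM {Suc n} (\<lambda>_. borel)) (\<lambda>\<omega>. restrict (\<lambda>i. \<gamma> i \<omega>) {Suc n})"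
    unfolding N_def Z_def by (rule indep_var_restrict[OF indep]) auto
  then have [measurable]: "Z \<in> measurable M N" by (rule indep_var_rv1)
  define u where "u x = (x - xs) - h *\<^sub>R grad F x" for x
  define w where "w x = h *\<^sub>R \<sigma> (real n * h) x" for x
  have [measurable]: "u \<in> borel_measurable borel" "w \<in> borel_measurable borel"
    unfolding u_def[abs_def] w_def[abs_def] by measurable
  have uT: "(\<lambda>z. u (T z)) \<in> borel_measurable N" and wT: "(\<lambda>z. w (T z)) \<in> borel_measurable N" by measurable
  have [measurable]: "X n \<in> borel_measurable M"
    unfolding XT[abs_def] by measurable
  have step: "X (Suc n) \<omega> - xs = u (X n \<omega>) + w (X n \<omega>) *v \<gamma> (Suc n) \<omega>" for \<omega>
    by (simp add: X u_def w_def scaleR_matrix_vector_assoc)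
  have u_le: "(norm (u x))\<^sup>2 \<le> (1 - 2 * \<mu> * h + L\<^sup>2 * h\<^sup>2) * (norm (x - xs))\<^sup>2" for x
    unfolding u_def by (rule step_norm[OF grad_mono grad_le h(1)])
  have w_le: "(norm (w x))\<^sup>2 \<le> 2 * S\<^sup>2 * h\<^sup>2 * (norm (x - xs))\<^sup>2 + 2 * S\<^sup>2 * h\<^sup>2" for x
  proof -
    have "(norm (w x))\<^sup>2 = h\<^sup>2 * (norm (\<sigma> (real n * h) x))\<^sup>2"
      by (simp add: w_def power_mult_distrib)
    also have "\<dots> \<le> h\<^sup>2 * (S * (1 + norm (x - xs)))\<^sup>2"
      using h by (intro mult_left_mono power_mono \<sigma>_le) auto
    also have "\<dots> = h\<^sup>2 * S\<^sup>2 * (1 + norm (x - xs))\<^sup>2" by (simp add: power_mult_distrib)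
    \<comment> \<open>Linear growth of \<sigma> is split so that one part multiplies the second
      moment and the other is a constant source of order h squared.\<close>
    also have "\<dots> \<le> h\<^sup>2 * S\<^sup>2 * (2 * (norm (x - xs))\<^sup>2 + 2)"
      using sum_squares_bound[of 1 "norm (x - xs)"]
      by (intro mult_left_mono) (auto simp: power2_sum)
    finally show ?thesis by (simp add: algebra_simps)
  qed
  have int_u: "integrable M (\<lambda>\<omega>. (norm (u (X n \<omega>)))\<^sup>2)"
    by (rule Bochner_Integration.integrable_bound[OF integrable_mult_right[OF int, of "1 - 2 * \<mu> * h + L\<^sup>2 * h\<^sup>2"]])
      (auto intro: order_trans[OF u_le abs_ge_self])
  have int_w: "integrable M (\<lambda>\<omega>. (norm (w (X n \<omega>)))\<^sup>2)"
    by (rule Bochner_Integration.integrable_bound[where f = "\<lambda>\<omega>. 2 * S\<^sup>2 * h\<^sup>2 * (norm (X n \<omega> - xs))\<^sup>2 + 2 * S\<^sup>2 * h\<^sup>2"])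
      (auto intro!: order_trans[OF w_le abs_ge_self] int simp del: abs_of_nonneg)
  \<comment> \<open>The map \<open>r\<close> of the general lemma is evaluation of the one-element
    family at \<open>Suc n\<close>.\<close>
  note G = indep_gaussian_step[OF ind measurable_component_singleton[of "Suc n"] _ gaussian[of "Suc n"] uT wT, folded XT, folded step, OF _ _ _ int_u int_w, simplified]
  show "integrable M (\<lambda>\<omega>. (norm (X (Suc n) \<omega> - xs))\<^sup>2)" by (rule G(1))
  have "expectation (\<lambda>\<omega>. (norm (X (Suc n) \<omega> - xs))\<^sup>2)
      = expectation (\<lambda>\<omega>. (norm (u (X n \<omega>)))\<^sup>2) + expectation (\<lambda>\<omega>. (norm (w (X n \<omega>)))\<^sup>2)" by (rule G(2))
  also have "\<dots> \<le> expectation (\<lambda>\<omega>. (1 - 2 * \<mu> * h + L\<^sup>2 * h\<^sup>2) * (norm (X n \<omega> - xs))\<^sup>2)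
      + expectation (\<lambda>\<omega>. 2 * S\<^sup>2 * h\<^sup>2 * (norm (X n \<omega> - xs))\<^sup>2 + 2 * S\<^sup>2 * h\<^sup>2)"
    using int int_u int_w by (intro add_mono integral_mono u_le w_le) auto
  also have "\<dots> = (1 - 2 * \<mu> * h + (L\<^sup>2 + 2 * S\<^sup>2) * h\<^sup>2) * expectation (\<lambda>\<omega>. (norm (X n \<omega> - xs))\<^sup>2) + 2 * S\<^sup>2 * h\<^sup>2"
    using int by (simp add: prob_space algebra_simps)
  finally show "expectation (\<lambda>\<omega>. (norm (X (Suc n) \<omega> - xs))\<^sup>2)
      \<le> (1 - 2 * \<mu> * h + (L\<^sup>2 + 2 * S\<^sup>2) * h\<^sup>2) * expectation (\<lambda>\<omega>. (norm (X n \<omega> - xs))\<^sup>2) + 2 * S\<^sup>2 * h\<^sup>2" .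
  \<comment> \<open>Expectation commutes with the linear part \<open>A\<close>; only the mean of the
    remainder \<open>R\<close> is left, and it is at most \<open>K\<close> times the second
    moment.\<close>
  define R where "R x = grad F x - A (x - xs)" for x
  have iY: "integrable M (\<lambda>\<omega>. X n \<omega> - xs)"
    by (rule integrable_of_square_norm) (use int in auto)
  have iA: "integrable M (\<lambda>\<omega>. A (X n \<omega> - xs))"
    by (rule integrable_bounded_linear[OF A(1) iY])
  have ig: "integrable M (\<lambda>\<omega>. grad F (X n \<omega>))"
    by (rule Bochner_Integration.integrable_bound[OF integrable_mult_right[OF integrable_norm[OF iY], of L]])
      (auto intro: order_trans[OF grad_le abs_ge_self] simp del: abs_mult)
  have iR: "integrable M (\<lambda>\<omega>. R (X n \<omega>))" unfolding R_def using ig iA by (rule Bochner_Integration.integrable_diff)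
  have "expectation (\<lambda>\<omega>. X (Suc n) \<omega> - xs) = expectation (\<lambda>\<omega>. u (X n \<omega>))" by (rule G(3))
  also have "\<dots> = expectation (\<lambda>\<omega>. (X n \<omega> - xs) - h *\<^sub>R A (X n \<omega> - xs) - h *\<^sub>R R (X n \<omega>))"
    by (simp add: u_def R_def algebra_simps)
  also have "\<dots> = expectation (\<lambda>\<omega>. X n \<omega> - xs) - h *\<^sub>R A (expectation (\<lambda>\<omega>. X n \<omega> - xs))
      - h *\<^sub>R expectation (\<lambda>\<omega>. R (X n \<omega>))"
    using iY iA iR integral_bounded_linear[OF A(1) iY] by simp
  finally have "norm (expectation (\<lambda>\<omega>. X (Suc n) \<omega> - xs))
      \<le> norm (expectation (\<lambda>\<omega>. X n \<omega> - xs) - h *\<^sub>R A (expectation (\<lambda>\<omega>. X n \<omega> - xs)))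
        + norm (h *\<^sub>R expectation (\<lambda>\<omega>. R (X n \<omega>)))"
    by (simp only: norm_triangle_ineq4)
  also have "norm (h *\<^sub>R expectation (\<lambda>\<omega>. R (X n \<omega>))) = h * norm (expectation (\<lambda>\<omega>. R (X n \<omega>)))"
    using h by simp
  also have "norm (expectation (\<lambda>\<omega>. R (X n \<omega>))) \<le> expectation (\<lambda>\<omega>. K * (norm (X n \<omega> - xs))\<^sup>2)"
    using int iR grad_lin by (intro order_trans[OF integral_norm_bound] integral_mono) (auto simp: R_def)
  also have "expectation (\<lambda>\<omega>. K * (norm (X n \<omega> - xs))\<^sup>2) = K * expectation (\<lambda>\<omega>. (norm (X n \<omega> - xs))\<^sup>2)"
    by simp
  finally show "norm (expectation (\<lambda>\<omega>. X (Suc n) \<omega> - xs))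
      \<le> (1 - \<mu> * h + L\<^sup>2 / 2 * h\<^sup>2) * norm (expectation (\<lambda>\<omega>. X n \<omega> - xs))
        + h * K * expectation (\<lambda>\<omega>. (norm (X n \<omega> - xs))\<^sup>2)"
    using linear_step_norm[OF h, of "expectation (\<lambda>\<omega>. X n \<omega> - xs)"] h by (simp add: mult.assoc)
qed

lemma sg_scheme_bounds:
  assumes "0 < hmax"
  obtains H c where "0 < H" "H < hmax" "0 < c"
    "\<And>x0 h N. 0 < h \<Longrightarrow> h < H \<Longrightarrow> integrable M (\<lambda>\<omega>. (norm (sg_scheme F \<sigma> \<gamma> x0 h N \<omega> - xs))\<^sup>2)"
    "\<And>x0 h N. 0 < h \<Longrightarrow> h < H \<Longrightarrow> expectation (\<lambda>\<omega>. (norm (sg_scheme F \<sigma> \<gamma> x0 h N \<omega> - xs))\<^sup>2)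
      \<le> c * (1 + (norm (x0 - xs))\<^sup>2) * (exp (- 2 * \<mu> * real N * h) + h)"
    "\<And>x0 h N. 0 < h \<Longrightarrow> h < H \<Longrightarrow> norm (expectation (\<lambda>\<omega>. sg_scheme F \<sigma> \<gamma> x0 h N \<omega> - xs))
      \<le> c * (1 + norm (x0 - xs) + (norm (x0 - xs))\<^sup>2) * (exp (- \<mu> * real N * h) + h)"
proof -
  define B where "B = L\<^sup>2 + 2 * S\<^sup>2"
  define D where "D = 2 * S\<^sup>2 / \<mu>"
  \<comment> \<open>The three bounds give \<open>H < hmax\<close>,
    \<open>2 * \<mu> * h \<le> 1\<close> and \<open>B * h \<le> \<mu> / 2\<close>. Using
    \<open>B + 1\<close> avoids a division by zero when \<open>B\<close> vanishes.\<close>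
  define H where "H = min (hmax / 2) (min (1 / (2 * \<mu>)) (\<mu> / (2 * (B + 1))))"
  define c1 where "c1 = exp B + 1 / \<mu> + D"
  define c2 where "c2 = (exp (L\<^sup>2 / 2) + 2 / \<mu>) * (1 + 2 * K / \<mu>) + 2 * K * D / \<mu>"
  have B: "0 \<le> B" "L\<^sup>2 \<le> B" by (auto simp: B_def)
  have D: "0 \<le> D" using const by (simp add: D_def)
  have c1: "0 < c1" using D const by (auto simp: c1_def intro!: add_pos_nonneg)
  have K: "0 \<le> 2 * K / \<mu>" "0 \<le> 2 * K * D / \<mu>" using const D by auto
  have "0 < exp (L\<^sup>2 / 2) + 2 / \<mu>" using const by (intro add_pos_pos) auto
  moreover have "0 < 1 + 2 * K / \<mu>" using K by linarith
  ultimately have c2: "0 < c2" using K unfolding c2_def by (simp only: add_pos_nonneg mult_pos_pos)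
  have H: "0 < H" "H < hmax" using assms const B by (auto simp: H_def)
  have *: "integrable M (\<lambda>\<omega>. (norm (sg_scheme F \<sigma> \<gamma> x0 h N \<omega> - xs))\<^sup>2) \<and>
      expectation (\<lambda>\<omega>. (norm (sg_scheme F \<sigma> \<gamma> x0 h N \<omega> - xs))\<^sup>2)
        \<le> c1 * (1 + (norm (x0 - xs))\<^sup>2) * (exp (- 2 * \<mu> * real N * h) + h) \<and>
      norm (expectation (\<lambda>\<omega>. sg_scheme F \<sigma> \<gamma> x0 h N \<omega> - xs))
        \<le> c2 * (1 + norm (x0 - xs) + (norm (x0 - xs))\<^sup>2) * (exp (- \<mu> * real N * h) + h)"
    if h: "0 < h" "h < H" for x0 h N
  proof -
    define X where "X = sg_scheme F \<sigma> \<gamma> x0 h"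
    define a where "a = norm (x0 - xs)"
    define m where "m n = expectation (\<lambda>\<omega>. (norm (X n \<omega> - xs))\<^sup>2)" for n
    define b where "b n = norm (expectation (\<lambda>\<omega>. X n \<omega> - xs))" for n
    define p where "p = 1 - 2 * \<mu> * h + B * h\<^sup>2"
    define q where "q = 1 - \<mu> * h + L\<^sup>2 / 2 * h\<^sup>2"
    have a: "0 \<le> a" by (simp add: a_def)
    have \<mu>h: "2 * \<mu> * h \<le> 1"
    proof -
      have "h \<le> 1 / (2 * \<mu>)" using h by (simp add: H_def)
      then show ?thesis using const by (simp add: field_simps)
    qed
    have Bh: "B * h \<le> \<mu> / 2"
    proof -
      have "h \<le> \<mu> / (2 * (B + 1))" using h by (simp add: H_def)
      then have "(B + 1) * h \<le> \<mu> / 2" using B by (simp add: field_simps)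
      then show ?thesis using h by (simp add: algebra_simps)
    qed
    have \<mu>h0: "0 < \<mu> * h" using const h by simp
    have Bh2: "0 \<le> B * h\<^sup>2" "B * h\<^sup>2 \<le> \<mu> * h / 2"
      using mult_right_mono[OF Bh, of h] h B by (auto simp: power2_eq_square mult.assoc)
    have Lh: "L\<^sup>2 / 2 * h \<le> \<mu> / 2"
    proof -
      have "L\<^sup>2 / 2 * h \<le> B * h" using B h by (intro mult_right_mono) auto
      then show ?thesis using Bh by linarith
    qed
    have Lh2: "0 \<le> L\<^sup>2 / 2 * h\<^sup>2" "L\<^sup>2 / 2 * h\<^sup>2 \<le> \<mu> * h / 2"
      using mult_right_mono[OF Lh, of h] h by (simp, simp add: power2_eq_square mult.assoc)
    have p: "0 \<le> p" "p \<le> 1 - \<mu> * h"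
      using \<mu>h \<mu>h0 Bh2 unfolding p_def by linarith+
    \<comment> \<open>The difference \<open>q - p\<close> is \<open>\<mu> * h\<close> up to a
      correction of order h squared, which the choice of \<open>H\<close> keeps below half of it;
      the same holds for \<open>1 - q\<close>.\<close>
    have q: "0 \<le> q" "\<mu> * h / 2 \<le> q - p" "\<mu> * h / 2 \<le> 1 - q"
      using \<mu>h \<mu>h0 Bh2 Lh2 unfolding p_def q_def by linarith+
    have \<mu>h1: "\<mu> * h \<le> 1" using \<mu>h \<mu>h0 by linarith
    have int: "integrable M (\<lambda>\<omega>. (norm (X n \<omega> - xs))\<^sup>2)" for n
    proof (induction n)
      case (Suc n)
      show ?case by (rule moment_step(1)[OF h(1) \<mu>h1 X_def Suc])
    qed (simp add: X_def)
    have m_rec: "m (Suc n) \<le> p * m n + (2 * S\<^sup>2) * h\<^sup>2" for n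
      unfolding m_def p_def B_def by (rule moment_step(2)[OF h(1) \<mu>h1 X_def int])
    have m_le: "m n \<le> p ^ n * a\<^sup>2 + D * h" for n
      using affine_recursion_bound[of m p "2 * S\<^sup>2" h \<mu> n, OF m_rec p const(1) h(1)]
      by (simp add: m_def X_def a_def D_def prob_space)
    have b_rec: "b (Suc n) \<le> q * b n + h * K * (p ^ n * a\<^sup>2 + D * h)" for n
    proof -
      have "b (Suc n) \<le> q * b n + h * K * m n"
        unfolding b_def m_def q_def by (rule moment_step(3)[OF h(1) \<mu>h1 X_def int])
      also have "h * K * m n \<le> h * K * (p ^ n * a\<^sup>2 + D * h)"
        using h const by (intro mult_left_mono m_le) auto
      finally show ?thesis by simp
    qed
    have b_le: "b n \<le> q ^ n * (a + 2 * K * a\<^sup>2 / \<mu>) + 2 * K * D / \<mu> * h" for n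
      using forced_recursion_bound[of b q h K p "a\<^sup>2" D \<mu> n, OF b_rec p(1) q const(1) h(1) const(4)] D
      by (simp add: b_def X_def a_def prob_space)
    let ?e1 = "exp (- \<mu> * real N * h)" and ?e2 = "exp (- 2 * \<mu> * real N * h)"
    \<comment> \<open>Powers are converted to exponentials only after both recursions are solved:
      the comparison of forcing and bias uses the exact factors \<open>p\<close> and
      \<open>q\<close>.\<close>
    have pN: "p ^ N \<le> exp B * ?e2 + 1 / \<mu> * h"
      using perturbed_power_bound[of "2 * \<mu>" B h N] const B h Bh \<mu>h unfolding p_def by (simp add: mult_ac)
    have qN: "q ^ N \<le> exp (L\<^sup>2 / 2) * ?e1 + 2 / \<mu> * h"
      unfolding q_def by (rule perturbed_power_bound) (use const h Lh \<mu>h1 in auto)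
    have "m N \<le> c1 * (1 + a\<^sup>2) * (?e2 + h)"
    proof -
      have "m N \<le> (exp B * ?e2 + 1 / \<mu> * h) * a\<^sup>2 + D * h"
        using m_le[of N] mult_right_mono[OF pN, of "a\<^sup>2"] by simp
      also have "\<dots> \<le> ((exp B + 1 / \<mu>) * (?e2 + h)) * (1 + a\<^sup>2) + D * (?e2 + h) * (1 + a\<^sup>2)"
      proof (rule add_mono)
        have "exp B * ?e2 + 1 / \<mu> * h \<le> (exp B + 1 / \<mu>) * (?e2 + h)"
          using const h by (simp add: algebra_simps)
        then show "(exp B * ?e2 + 1 / \<mu> * h) * a\<^sup>2 \<le> ((exp B + 1 / \<mu>) * (?e2 + h)) * (1 + a\<^sup>2)"
          using const h by (intro mult_mono) auto
        show "D * h \<le> D * (?e2 + h) * (1 + a\<^sup>2)"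
        proof -
          have "D * h * 1 \<le> D * (?e2 + h) * (1 + a\<^sup>2)"
            using D h by (intro mult_mono) auto
          then show ?thesis by simp
        qed
      qed
      also have "\<dots> = c1 * (1 + a\<^sup>2) * (?e2 + h)" unfolding c1_def by (simp only: distrib_left distrib_right ac_simps)
      finally show ?thesis .
    qed
    moreover have "b N \<le> c2 * (1 + a + a\<^sup>2) * (?e1 + h)"
    proof -
      let ?k = "1 + 2 * K / \<mu>" and ?l = "exp (L\<^sup>2 / 2) + 2 / \<mu>"
      have "b N \<le> q ^ N * (a + 2 * K * a\<^sup>2 / \<mu>) + 2 * K * D / \<mu> * h" by (rule b_le)
      also have "\<dots> \<le> (?l * (?e1 + h)) * (?k * (1 + a + a\<^sup>2)) + (2 * K * D / \<mu> * (?e1 + h)) * (1 + a + a\<^sup>2)"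
      proof (rule add_mono)
        have "exp (L\<^sup>2 / 2) * ?e1 + 2 / \<mu> * h \<le> ?l * (?e1 + h)"
          using const h by (simp add: algebra_simps)
        then have 1: "q ^ N \<le> ?l * (?e1 + h)" using qN by linarith
        have "a + 2 * K / \<mu> * a\<^sup>2 \<le> ?k * (1 + a + a\<^sup>2)"
        proof -
          have "2 * K / \<mu> * a\<^sup>2 \<le> 2 * K / \<mu> * (1 + a + a\<^sup>2)" using a K by (intro mult_left_mono) auto
          moreover have "?k * (1 + a + a\<^sup>2) = (1 + a + a\<^sup>2) + 2 * K / \<mu> * (1 + a + a\<^sup>2)"
            by (simp add: distrib_right)
          ultimately show ?thesis using zero_le_power2[of a] by linarith
        qed
        then have 2: "a + 2 * K * a\<^sup>2 / \<mu> \<le> ?k * (1 + a + a\<^sup>2)" by simp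
        have 3: "0 \<le> ?l * (?e1 + h)" using const h by (intro mult_nonneg_nonneg add_nonneg_nonneg) auto
        have 4: "0 \<le> a + 2 * K * a\<^sup>2 / \<mu>" using const a by auto
        show "q ^ N * (a + 2 * K * a\<^sup>2 / \<mu>) \<le> (?l * (?e1 + h)) * (?k * (1 + a + a\<^sup>2))"
          by (rule mult_mono[OF 1 2 3 4])
        show "2 * K * D / \<mu> * h \<le> 2 * K * D / \<mu> * (?e1 + h) * (1 + a + a\<^sup>2)"
        proof -
          have "2 * K * D / \<mu> * h * 1 \<le> 2 * K * D / \<mu> * (?e1 + h) * (1 + a + a\<^sup>2)"
            using K h a by (intro mult_mono mult_left_mono mult_nonneg_nonneg[OF K(2)]) auto
          then show ?thesis by simp
        qed
      qed
      also have "\<dots> = c2 * (1 + a + a\<^sup>2) * (?e1 + h)" unfolding c2_def by (simp only: distrib_left distrib_right ac_simps)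
      finally show ?thesis .
    qed
    ultimately show ?thesis using int[of N] by (simp add: m_def b_def X_def a_def)
  qed
  show thesis
  proof (rule that[of H "max c1 c2"])
    fix x0 h N assume h: "0 < h" "h < H"
    note B = *[OF h, of x0 N]
    show "integrable M (\<lambda>\<omega>. (norm (sg_scheme F \<sigma> \<gamma> x0 h N \<omega> - xs))\<^sup>2)" using B by simp
    have "c1 * (1 + (norm (x0 - xs))\<^sup>2) * (exp (- 2 * \<mu> * real N * h) + h)
        \<le> max c1 c2 * (1 + (norm (x0 - xs))\<^sup>2) * (exp (- 2 * \<mu> * real N * h) + h)"
      using h by (intro mult_right_mono) auto
    then show "expectation (\<lambda>\<omega>. (norm (sg_scheme F \<sigma> \<gamma> x0 h N \<omega> - xs))\<^sup>2)
      \<le> max c1 c2 * (1 + (norm (x0 - xs))\<^sup>2) * (exp (- 2 * \<mu> * real N * h) + h)" using B by linarith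
    have "c2 * (1 + norm (x0 - xs) + (norm (x0 - xs))\<^sup>2) * (exp (- \<mu> * real N * h) + h)
        \<le> max c1 c2 * (1 + norm (x0 - xs) + (norm (x0 - xs))\<^sup>2) * (exp (- \<mu> * real N * h) + h)"
      using h by (intro mult_right_mono) auto
    then show "norm (expectation (\<lambda>\<omega>. sg_scheme F \<sigma> \<gamma> x0 h N \<omega> - xs))
      \<le> max c1 c2 * (1 + norm (x0 - xs) + (norm (x0 - xs))\<^sup>2) * (exp (- \<mu> * real N * h) + h)" using B by linarith
  qed (use H c1 in auto)
qed

end

text \<open>Since the gradient vanishes at the minimizer, the two-point assumptions specialize to
  the one-point estimates of the locale. The bounded function \<open>\<zeta>\<close> is replaced by
  a constant \<open>S\<close>.\<close>

lemma sg_iteration_minimizer: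
  fixes M :: "'w measure"
    and F :: "real^'n \<Rightarrow> real"
  assumes "prob_space M"
    and indep: "prob_space.indep_vars M (\<lambda>_. borel) \<gamma> {1..}"
    and gaussian: "\<And>n. n \<ge> 1 \<Longrightarrow> std_gaussian M (\<gamma> n)"
    and F: "F_basic F \<mu>" and \<sigma>: "sigma_basic \<sigma> (minimizer F)"
  obtains A L S K where "sg_iteration M \<gamma> F \<sigma> (minimizer F) A \<mu> L S K"
proof -
  interpret prob_space M by fact
  define xs where "xs = minimizer F"
  obtain L where L: "0 < L" "\<And>x1 x2. norm (grad F x2 - grad F x1) \<le> L * norm (x2 - x1)"
    and mono: "\<And>x1 x2. (grad F x2 - grad F x1) \<bullet> (x2 - x1) \<ge> \<mu> * (norm (x2 - x1))\<^sup>2"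
    and \<mu>: "0 < \<mu>" and C3: "C_class 3 F" "bounded_Dm 3 F"
    using F unfolding F_basic_def by blast
  have diff: "F differentiable (at x)" for x using C3(1) by (simp add: numeral_3_eq_3)
  have g0: "grad F xs = 0"
    unfolding xs_def by (rule strongly_monotone_grad_minimizer(1)[OF diff \<mu> mono])
  obtain \<zeta> where \<zeta>: "bounded (\<zeta> ` {0..})"
    "\<And>t x1 x2. 0 \<le> t \<Longrightarrow> norm (\<sigma> t x2 - \<sigma> t x1) \<le> \<zeta> t * norm (x2 - x1)"
    "\<And>t x. 0 \<le> t \<Longrightarrow> norm (\<sigma> t x) / (1 + norm (x - xs)) \<le> \<zeta> t"
    using \<sigma> unfolding sigma_basic_def xs_def by blast
  obtain S where S: "0 < S" "\<And>t. 0 \<le> t \<Longrightarrow> \<bar>\<zeta> t\<bar> \<le> S"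
    using \<zeta>(1) unfolding bounded_pos by auto
  obtain A K where A: "bounded_linear A" "0 \<le> K"
    and lin: "\<And>y. norm (grad F (xs + y) - grad F xs - A y) \<le> K * (norm y)\<^sup>2"
    using grad_linearization[OF C3] by blast
  obtain L' where L': "0 < L'" "\<And>y. norm (A y) \<le> norm y * L'"
    using bounded_linear.pos_bounded[OF A(1)] by blast
  \<comment> \<open>Taking the maximum with an operator bound \<open>L'\<close> for \<open>A\<close>
    spares comparing that bound with the Lipschitz constant.\<close>
  have "sg_iteration M \<gamma> F \<sigma> xs A \<mu> (max L L') S K"
  proof (intro sg_iteration.intro sg_iteration_axioms.intro)
    show "norm (grad F x) \<le> max L L' * norm (x - xs)" for x
      using L(2)[of x xs] mult_right_mono[of L "max L L'" "norm (x - xs)"] by (simp add: g0)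
    show "norm (A y) \<le> max L L' * norm y" for y
      using L'(2)[of y] mult_right_mono[of L' "max L L'" "norm y"] by (simp add: mult.commute)
    show "\<mu> * (norm (x - xs))\<^sup>2 \<le> grad F x \<bullet> (x - xs)" for x
      using mono[of x xs] by (simp add: g0)
    show "\<mu> * (norm y)\<^sup>2 \<le> A y \<bullet> y" for y
    proof (rule linearization_coercive)
      show "linear A" by (rule bounded_linear.linear[OF A(1)])
      show "norm (grad F (xs + y) - A y) \<le> K * (norm y)\<^sup>2" for y using lin[of y] by (simp add: g0)
      show "\<mu> * (norm y)\<^sup>2 \<le> grad F (xs + y) \<bullet> y" for y
        using mono[of "xs + y" xs] by (simp add: g0)
    qed
    show "norm (grad F x - A (x - xs)) \<le> K * (norm (x - xs))\<^sup>2" for x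
      using lin[of "x - xs"] by (simp add: g0)
    have "L-lipschitz_on UNIV (grad F)"
      using L by (intro lipschitz_onI) (auto simp: dist_norm)
    then show "continuous_on UNIV (grad F)" by (rule lipschitz_on_continuous_on)
    show "continuous_on UNIV (\<sigma> t)" if "0 \<le> t" for t
    proof -
      have "\<bar>\<zeta> t\<bar>-lipschitz_on UNIV (\<sigma> t)"
      proof (rule lipschitz_onI)
        show "dist (\<sigma> t x) (\<sigma> t y) \<le> \<bar>\<zeta> t\<bar> * dist x y" for x y
          using \<zeta>(2)[OF that, of x y] mult_right_mono[OF abs_ge_self[of "\<zeta> t"] norm_ge_zero[of "x - y"]]
          by (simp add: dist_norm)
      qed simp
      then show ?thesis by (rule lipschitz_on_continuous_on)
    qed
    show "norm (\<sigma> t x) \<le> S * (1 + norm (x - xs))" if "0 \<le> t" for t x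
    proof -
      have "norm (\<sigma> t x) / (1 + norm (x - xs)) \<le> S"
        using \<zeta>(3)[OF that, of x] S(2)[OF that] by linarith
      then show ?thesis by (simp add: divide_le_eq add_pos_nonneg)
    qed
  qed (use \<mu> L L' S A indep gaussian prob_space_axioms in auto)
  then show thesis using that unfolding xs_def by blast
qed

section \<open>Weak error, expected residual and strong error from the moment and bias
  estimates\<close>

theorem theorem1:
  fixes M :: "'w measure"
    and \<gamma> :: "nat \<Rightarrow> 'w \<Rightarrow> real^'n"
    and F :: "real^'n \<Rightarrow> real"
    and \<sigma> :: "real \<Rightarrow> real^'n \<Rightarrow> real^'n^'n"
    and \<mu> hmax :: real
  defines "xstar \<equiv> minimizer F"
  assumes "prob_space M"
    and "prob_space.indep_vars M (\<lambda>_. borel) \<gamma> {1..}"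
    and "\<And>n. n \<ge> 1 \<Longrightarrow> std_gaussian M (\<gamma> n)"
    and "hmax > 0"
    and "F_basic F \<mu>"
    and "sigma_basic \<sigma> xstar"
  shows "\<exists>H C. 0 < H \<and> H < hmax \<and> 0 < C \<and>
    (\<forall>x0 N h. N \<ge> 1 \<longrightarrow> 0 < h \<longrightarrow> h < H \<longrightarrow>
      (let X = sg_scheme F \<sigma> \<gamma> x0 h in
        (\<forall>\<phi>. C_class 2 \<phi> \<longrightarrow> bounded_Dm 2 \<phi> \<longrightarrow>
           integrable M (\<lambda>\<omega>. \<phi> (X N \<omega>)) \<and>
           \<bar>(\<integral>\<omega>. \<phi> (X N \<omega>) \<partial>M) - \<phi> xstar\<bar>
             \<le> C * (norm (grad \<phi> xstar) + Dm_norm 2 \<phi>) * (1 + norm (x0 - xstar) ^ 3)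
                * (exp (- \<mu> * real N * h) + h)) \<and>
        (integrable M (\<lambda>\<omega>. F (X N \<omega>)) \<and>
           (\<integral>\<omega>. F (X N \<omega>) \<partial>M) - F xstar
             \<le> C * (1 + norm (x0 - xstar) ^ 3) * (exp (- 2 * \<mu> * real N * h) + h)) \<and>
        (integrable M (\<lambda>\<omega>. norm (X N \<omega> - xstar)) \<and>
         integrable M (\<lambda>\<omega>. (norm (X N \<omega> - xstar))\<^sup>2) \<and>
           (\<integral>\<omega>. norm (X N \<omega> - xstar) \<partial>M)
             \<le> sqrt (\<integral>\<omega>. (norm (X N \<omega> - xstar))\<^sup>2 \<partial>M) \<and>
           sqrt (\<integral>\<omega>. (norm (X N \<omega> - xstar))\<^sup>2 \<partial>M)
             \<le> C * (1 + norm (x0 - xstar) powr (3/2))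
                * (exp (- \<mu> * real N * h) + sqrt h))))"
proof -
  obtain A L S K where "sg_iteration M \<gamma> F \<sigma> xstar A \<mu> L S K"
    using sg_iteration_minimizer[OF assms(2-4,6) assms(7)[unfolded xstar_def]] unfolding xstar_def by blast
  then interpret sg_iteration M \<gamma> F \<sigma> xstar A \<mu> L S K .
  obtain H c where H: "0 < H" "H < hmax" and c: "0 < c"
    and sq: "\<And>x0 h N. 0 < h \<Longrightarrow> h < H \<Longrightarrow> integrable M (\<lambda>\<omega>. (norm (sg_scheme F \<sigma> \<gamma> x0 h N \<omega> - xstar))\<^sup>2)"
    and moment: "\<And>x0 h N. 0 < h \<Longrightarrow> h < H \<Longrightarrow> expectation (\<lambda>\<omega>. (norm (sg_scheme F \<sigma> \<gamma> x0 h N \<omega> - xstar))\<^sup>2)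
      \<le> c * (1 + (norm (x0 - xstar))\<^sup>2) * (exp (- 2 * \<mu> * real N * h) + h)"
    and bias: "\<And>x0 h N. 0 < h \<Longrightarrow> h < H \<Longrightarrow> norm (expectation (\<lambda>\<omega>. sg_scheme F \<sigma> \<gamma> x0 h N \<omega> - xstar))
      \<le> c * (1 + norm (x0 - xstar) + (norm (x0 - xstar))\<^sup>2) * (exp (- \<mu> * real N * h) + h)"
    using sg_scheme_bounds[OF assms(5)] by blast
  have diff: "F differentiable (at x)" for x
    using assms(6) by (simp add: F_basic_def numeral_3_eq_3)
  have min: "F xstar \<le> F x" for x
    unfolding xstar_def
    by (rule strongly_monotone_grad_minimizer(2)[OF diff]) (use assms(6) in \<open>auto simp: F_basic_def\<close>)
  \<comment> \<open>One summand for each estimate: \<open>3 * c\<close> for the weak error,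
    \<open>2 * c * L\<close> for the residual, \<open>2 * sqrt c\<close> for the strong
    error.\<close>
  define C where "C = 3 * c + 2 * c * L + 2 * sqrt c"
  have C_ge: "3 * c \<le> C" "2 * c * L \<le> C" "2 * sqrt c \<le> C" and C: "0 < C"
    using c const by (auto simp: C_def add_pos_nonneg)
  show ?thesis
    unfolding Let_def
  proof (rule exI[of _ H], rule exI[of _ C], intro conjI H C allI impI)
    fix x0 :: "real^'n" and N :: nat and h :: real
    assume h: "0 < h" "h < H"
    define X where "X = sg_scheme F \<sigma> \<gamma> x0 h N"
    define a where "a = norm (x0 - xstar)"
    define e1 where "e1 = exp (- \<mu> * real N * h)"
    define e2 where "e2 = exp (- 2 * \<mu> * real N * h)"
    define m where "m = expectation (\<lambda>\<omega>. (norm (X \<omega> - xstar))\<^sup>2)"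
    have a: "0 \<le> a" by (simp add: a_def)
    have cube: "1 + a\<^sup>2 \<le> 2 * (1 + a ^ 3)" and cube': "1 + a + a\<^sup>2 \<le> 3 * (1 + a ^ 3)"
      using sq_le_one_plus_cube[OF a] zero_le_power[OF a, of 3] by argo+
    have e1: "0 < e1" and e2: "e2 = e1\<^sup>2" "0 < e2"
      by (simp_all add: e1_def e2_def exp_double[symmetric])
    have "0 \<le> \<mu> * real N * h" using const h by simp
    then have "e1 \<le> 1" by (simp add: e1_def)
    then have e21: "e2 \<le> e1" using e1 by (simp add: e2 power2_eq_square)
    have "\<gamma> i \<in> borel_measurable M" if "1 \<le> i" for i
      using distributed_measurable[OF gaussian[OF that, unfolded std_gaussian_def]] by simp
    then have X[measurable]: "X \<in> borel_measurable M"
      unfolding X_def using h by (intro sg_scheme_measurable) auto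
    have isq: "integrable M (\<lambda>\<omega>. (norm (X \<omega> - xstar))\<^sup>2)" unfolding X_def by (rule sq[OF h])
    have iY: "integrable M (\<lambda>\<omega>. X \<omega> - xstar)"
      by (rule integrable_of_square_norm) (use isq in auto)
    have m0: "0 \<le> m" unfolding m_def by simp
    have m_le: "m \<le> c * (1 + a\<^sup>2) * (e2 + h)"
      unfolding m_def X_def a_def e2_def by (rule moment[OF h])
    have "c * (1 + a\<^sup>2) * (e2 + h) \<le> c * (2 * (1 + a ^ 3)) * (e2 + h)"
      using c cube e2 h by (intro mult_right_mono mult_left_mono) auto
    then have m_cube: "m \<le> 2 * c * (1 + a ^ 3) * (e2 + h)" using m_le by (simp only: mult_ac)
    have b_le: "norm (expectation (\<lambda>\<omega>. X \<omega> - xstar)) \<le> 3 * c * (1 + a ^ 3) * (e1 + h)"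
    proof -
      have "norm (expectation (\<lambda>\<omega>. X \<omega> - xstar)) \<le> c * (1 + a + a\<^sup>2) * (e1 + h)"
        unfolding X_def a_def e1_def by (rule bias[OF h])
      also have "\<dots> \<le> c * (3 * (1 + a ^ 3)) * (e1 + h)"
        using c cube' e1 h by (intro mult_right_mono mult_left_mono) auto
      finally show ?thesis by (simp only: mult_ac)
    qed
    show "integrable M (\<lambda>\<omega>. (norm (sg_scheme F \<sigma> \<gamma> x0 h N \<omega> - xstar))\<^sup>2)" by (rule sq[OF h])
    show "integrable M (\<lambda>\<omega>. norm (sg_scheme F \<sigma> \<gamma> x0 h N \<omega> - xstar))"
      using integrable_norm[OF iY] by (simp add: X_def)
    \<comment> \<open>This is the nonnegativity of the variance of the distance to
      \<open>xstar\<close>.\<close>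
    have "(expectation (\<lambda>\<omega>. norm (X \<omega> - xstar)))\<^sup>2 \<le> m"
      using variance_positive[of "\<lambda>\<omega>. norm (X \<omega> - xstar)"] variance_eq[OF integrable_norm[OF iY] isq]
      by (simp add: m_def)
    then show "expectation (\<lambda>\<omega>. norm (sg_scheme F \<sigma> \<gamma> x0 h N \<omega> - xstar))
        \<le> sqrt (expectation (\<lambda>\<omega>. (norm (sg_scheme F \<sigma> \<gamma> x0 h N \<omega> - xstar))\<^sup>2))"
      unfolding m_def X_def by (rule real_le_rsqrt)
    show "sqrt (expectation (\<lambda>\<omega>. (norm (sg_scheme F \<sigma> \<gamma> x0 h N \<omega> - xstar))\<^sup>2))
        \<le> C * (1 + norm (x0 - xstar) powr (3 / 2)) * (exp (- \<mu> * real N * h) + sqrt h)"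
    proof -
      have "sqrt m \<le> sqrt (c * (1 + a\<^sup>2) * (e2 + h))" using m_le by simp
      also have "\<dots> = sqrt c * sqrt (1 + a\<^sup>2) * sqrt (e2 + h)" by (simp add: real_sqrt_mult)
      also have "\<dots> \<le> sqrt c * (2 * (1 + a powr (3 / 2))) * (e1 + sqrt h)"
      proof (rule mult_mono[OF mult_left_mono])
        have "sqrt (1 + a\<^sup>2) \<le> 1 + a" using sqrt_add_le_add_sqrt[of 1 "a\<^sup>2"] a by simp
        moreover have "a \<le> 1 + a powr (3 / 2)" by (rule le_one_plus_powr[OF a]) simp
        moreover have "1 + (1 + a powr (3 / 2)) \<le> 2 * (1 + a powr (3 / 2))" by simp
        ultimately show "sqrt (1 + a\<^sup>2) \<le> 2 * (1 + a powr (3 / 2))" by linarith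
        \<comment> \<open>Because \<open>e2\<close> is the square of \<open>e1\<close>, taking the
          root halves the exponential rate and degrades h to its square root.\<close>
        show "sqrt (e2 + h) \<le> e1 + sqrt h"
          using sqrt_add_le_add_sqrt[of e2 h] e1 e2 h by simp
      qed (use c e2 h in \<open>auto simp: add_nonneg_nonneg\<close>)
      also have "\<dots> = 2 * sqrt c * ((1 + a powr (3 / 2)) * (e1 + sqrt h))" by simp
      also have "\<dots> \<le> C * ((1 + a powr (3 / 2)) * (e1 + sqrt h))"
        using C_ge e1 h by (intro mult_right_mono mult_nonneg_nonneg add_nonneg_nonneg) auto
      finally show ?thesis by (simp add: m_def X_def a_def e1_def mult.assoc)
    qed
    have F_bounds: "0 \<le> F x - F xstar" "F x - F xstar \<le> L * (norm (x - xstar))\<^sup>2" for x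
      using min[of x] gap_le_of_grad_growth[OF diff grad_le const(2)] by auto
    have F_meas[measurable]: "F \<in> borel_measurable borel"
      using diff by (intro borel_measurable_continuous_onI continuous_at_imp_continuous_on ballI
          differentiable_imp_continuous_within)
    \<comment> \<open>Minimality from below and quadratic growth from above sandwich the residual by
      an integrable function.\<close>
    have iF0: "integrable M (\<lambda>\<omega>. F (X \<omega>) - F xstar)"
      by (rule Bochner_Integration.integrable_bound[OF integrable_mult_right[OF isq, of L]])
        (use F_bounds const in \<open>auto simp: abs_of_nonneg\<close>)
    then have iF: "integrable M (\<lambda>\<omega>. F (X \<omega>))"
      using Bochner_Integration.integrable_add[OF iF0, of "\<lambda>_. F xstar"] by simp
    then show "integrable M (\<lambda>\<omega>. F (sg_scheme F \<sigma> \<gamma> x0 h N \<omega>))" by (simp add: X_def)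
    show "expectation (\<lambda>\<omega>. F (sg_scheme F \<sigma> \<gamma> x0 h N \<omega>)) - F xstar
        \<le> C * (1 + norm (x0 - xstar) ^ 3) * (exp (- 2 * \<mu> * real N * h) + h)"
    proof -
      have "expectation (\<lambda>\<omega>. F (X \<omega>)) - F xstar = expectation (\<lambda>\<omega>. F (X \<omega>) - F xstar)"
        using iF by (simp add: prob_space)
      also have "\<dots> \<le> expectation (\<lambda>\<omega>. L * (norm (X \<omega> - xstar))\<^sup>2)"
        using iF0 isq F_bounds by (intro integral_mono) auto
      also have "\<dots> = L * m" by (simp add: m_def)
      also have "\<dots> \<le> L * (2 * c * (1 + a ^ 3) * (e2 + h))" using const by (intro mult_left_mono m_cube)
      also have "\<dots> = 2 * c * L * ((1 + a ^ 3) * (e2 + h))" by simp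
      also have "\<dots> \<le> C * ((1 + a ^ 3) * (e2 + h))"
        using C_ge a e2 h by (intro mult_right_mono) auto
      finally show ?thesis by (simp add: X_def a_def e2_def mult.assoc)
    qed
    fix \<phi> :: "real^'n \<Rightarrow> real"
    assume \<phi>: "C_class 2 \<phi>" "bounded_Dm 2 \<phi>"
    define R where "R x = \<phi> x - \<phi> xstar - grad \<phi> xstar \<bullet> (x - xstar)" for x
    define d where "d = Dm_norm 2 \<phi>"
    have d: "0 \<le> d" unfolding d_def by (rule Dm_norm_nonneg[OF \<phi>(2)])
    have R: "\<bar>R x\<bar> \<le> d / 2 * (norm (x - xstar))\<^sup>2" for x
      using Taylor2_Dm_norm[OF \<phi>, of xstar "x - xstar"] by (simp add: R_def d_def)
    have "\<phi> differentiable (at x)" for x using \<phi>(1) by (simp add: numeral_2_eq_2)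
    then have [measurable]: "\<phi> \<in> borel_measurable borel"
      by (intro borel_measurable_continuous_onI continuous_at_imp_continuous_on ballI
          differentiable_imp_continuous_within)
    have [measurable]: "R \<in> borel_measurable borel" unfolding R_def[abs_def] by measurable
    have iR: "integrable M (\<lambda>\<omega>. R (X \<omega>))"
      by (rule Bochner_Integration.integrable_bound[OF integrable_mult_right[OF isq, of "d / 2"]])
        (use R d in auto)
    have iL: "integrable M (\<lambda>\<omega>. grad \<phi> xstar \<bullet> (X \<omega> - xstar))"
      using iY by (rule integrable_inner_right)
    have \<phi>_eq: "\<phi> (X \<omega>) = \<phi> xstar + grad \<phi> xstar \<bullet> (X \<omega> - xstar) + R (X \<omega>)" for \<omega>
      by (simp add: R_def)
    have i\<phi>: "integrable M (\<lambda>\<omega>. \<phi> (X \<omega>))" unfolding \<phi>_eq using iL iR by simp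
    then show "integrable M (\<lambda>\<omega>. \<phi> (sg_scheme F \<sigma> \<gamma> x0 h N \<omega>))" by (simp add: X_def)
    show "\<bar>expectation (\<lambda>\<omega>. \<phi> (sg_scheme F \<sigma> \<gamma> x0 h N \<omega>)) - \<phi> xstar\<bar>
        \<le> C * (norm (grad \<phi> xstar) + Dm_norm 2 \<phi>) * (1 + norm (x0 - xstar) ^ 3) * (exp (- \<mu> * real N * h) + h)"
    proof -
      let ?E = "(1 + a ^ 3) * (e1 + h)"
      have E: "0 \<le> ?E" using a e1 h by (intro mult_nonneg_nonneg) auto
      have "expectation (\<lambda>\<omega>. \<phi> (X \<omega>)) - \<phi> xstar
          = grad \<phi> xstar \<bullet> expectation (\<lambda>\<omega>. X \<omega> - xstar) + expectation (\<lambda>\<omega>. R (X \<omega>))"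
        unfolding \<phi>_eq using iL iR integral_inner_right[OF iY] by (simp add: prob_space)
      also have "\<bar>\<dots>\<bar> \<le> norm (grad \<phi> xstar) * norm (expectation (\<lambda>\<omega>. X \<omega> - xstar)) + \<bar>expectation (\<lambda>\<omega>. R (X \<omega>))\<bar>"
        by (intro order_trans[OF abs_triangle_ineq] add_right_mono Cauchy_Schwarz_ineq2)
      \<comment> \<open>The linear term sees only the bias and the remainder only the second moment.
        Both are of order \<open>e1 + h\<close>, because \<open>e2 \<le> e1\<close>, so no square
        root of h appears.\<close>
      also have "\<dots> \<le> norm (grad \<phi> xstar) * (3 * c * ?E) + d * (3 * c * ?E)"
      proof (intro add_mono mult_left_mono)
        show "norm (expectation (\<lambda>\<omega>. X \<omega> - xstar)) \<le> 3 * c * ?E" using b_le by (simp only: mult.assoc)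
        have "\<bar>expectation (\<lambda>\<omega>. R (X \<omega>))\<bar> \<le> expectation (\<lambda>\<omega>. \<bar>R (X \<omega>)\<bar>)"
          by (rule integral_abs_bound)
        also have "\<dots> \<le> expectation (\<lambda>\<omega>. d / 2 * (norm (X \<omega> - xstar))\<^sup>2)"
          using iR isq R by (intro integral_mono) auto
        also have "\<dots> = d / 2 * m" by (simp add: m_def)
        also have "\<dots> \<le> d / 2 * (2 * c * (1 + a ^ 3) * (e2 + h))" using d by (intro mult_left_mono m_cube) auto
        also have "\<dots> = d * (c * ((1 + a ^ 3) * (e2 + h)))" by simp
        also have "\<dots> \<le> d * (3 * c * ?E)"
          using d c a e21 e2 h by (intro mult_left_mono mult_mono) auto
        finally show "\<bar>expectation (\<lambda>\<omega>. R (X \<omega>))\<bar> \<le> d * (3 * c * ?E)" .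
      qed simp
      also have "\<dots> = 3 * c * ((norm (grad \<phi> xstar) + d) * ?E)" by (simp add: algebra_simps)
      also have "\<dots> \<le> C * ((norm (grad \<phi> xstar) + d) * ?E)"
        using C_ge d by (intro mult_right_mono mult_nonneg_nonneg[OF _ E]) auto
      finally show ?thesis by (simp add: X_def a_def d_def e1_def mult.assoc)
    qed
  qed
qed

end
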